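(* The space $(\mathcal D,\langle\cdot,\cdot\rangle_{\mathcal D})$ is a quaternionic right Hilbert space.
   Context: $\mathbb H$ denotes the quaternions with real part coordinate $x_0$, $\mathbb S^2$ the sphere of purely imaginary unit quaternions, $\mathbb C(i)=\{x+iy:x,y\in\mathbb R\}$ for $i\in\mathbb S^2$, $\mathbb B$ the open unit ball of $\mathbb H$, $\mathbb B_i=\mathbb B\cap\mathbb C(i)$. A real differentiable function $f:\mathbb B\to\mathbb H$ is (left) slice regular if for every $i\in\mathbb S^2$, $\left(\frac{\partial}{\partial x}+i\frac{\partial}{\partial y}\right)f(x+iy)=0$ on $\mathbb B_i$. The slice regular Dirichlet space $\mathcal D$ is the quaternionic right linear space of slice regular functions $f$ on $\mathbb B$ such that $\sup_{i\in\mathbb S^2}\int_{\mathbb B_i}|\partial_{x_0}f(z)|^2d\Omega_i(z)<\infty$, where $d\Omega_i=dx\,dy$ is the area element of $\mathbb C(i)$. For $f,g\in\mathcal D$, $$\langle f,g\rangle_{\mathcal D}=\overline{f(0)}\,g(0)+\int_{\mathbb B_i}\overline{\partial_{x_0}f(z)}\,\partial_{x_0}g(z)\,d\Omega_i(z),$$ where $i\in\mathbb S^2$ is arbitrary (the value of the integral does not depend on $i$). A quaternionic right Hilbert space is a right $\mathbb H$-linear space with an $\mathbb H$-valued form satisfying $\langle f,g\lambda+h\rangle=\langle f,g\rangle\lambda+\langle f,h\rangle$ for $\lambda\in\mathbb H$, $\langle g,f\rangle=\overline{\langle f,g\rangle}$, $\langle f,f\rangle\ge0$ with equality if and only if $f=0$,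 and complete with respect to the norm $\sqrt{\langle f,f\rangle}$. *)

theory Defs
  imports "HOL-Analysis.Analysis" "HOL-Library.Function_Algebras"
begin

section \<open>The quaternions\<close>

codatatype quat = Quat (Re0: real) (Im1: real) (Im2: real) (Im3: real)

lemma quat_eqI [intro?]:
  "Re0 x = Re0 y \<Longrightarrow> Im1 x = Im1 y \<Longrightarrow> Im2 x = Im2 y \<Longrightarrow> Im3 x = Im3 y \<Longrightarrow> x = y"
  by (rule quat.expand) simp

lemma quat_eq_iff:
  "x = y \<longleftrightarrow> Re0 x = Re0 y \<and> Im1 x = Im1 y \<and> Im2 x = Im2 y \<and> Im3 x = Im3 y"
  by (auto intro: quat_eqI)

instantiation quat :: ab_group_add
begin

primcorec zero_quat where
  "Re0 0 = 0"
| "Im1 0 = 0"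
| "Im2 0 = 0"
| "Im3 0 = 0"

primcorec plus_quat where
  "Re0 (x + y) = Re0 x + Re0 y"
| "Im1 (x + y) = Im1 x + Im1 y"
| "Im2 (x + y) = Im2 x + Im2 y"
| "Im3 (x + y) = Im3 x + Im3 y"

primcorec uminus_quat where
  "Re0 (- x) = - Re0 x"
| "Im1 (- x) = - Im1 x"
| "Im2 (- x) = - Im2 x"
| "Im3 (- x) = - Im3 x"

primcorec minus_quat where
  "Re0 (x - y) = Re0 x - Re0 y"
| "Im1 (x - y) = Im1 x - Im1 y"
| "Im2 (x - y) = Im2 x - Im2 y"
| "Im3 (x - y) = Im3 x - Im3 y"

instance
  by standard (simp_all add: quat_eq_iff)

end

text \<open>Hamilton's product: \<open>i\<^sup>2 = j\<^sup>2 = k\<^sup>2 = i j k = -1\<close>.\<close>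

instantiation quat :: ring_1
begin

primcorec one_quat where
  "Re0 1 = 1"
| "Im1 1 = 0"
| "Im2 1 = 0"
| "Im3 1 = 0"

primcorec times_quat where
  "Re0 (x * y) = Re0 x * Re0 y - Im1 x * Im1 y - Im2 x * Im2 y - Im3 x * Im3 y"
| "Im1 (x * y) = Re0 x * Im1 y + Im1 x * Re0 y + Im2 x * Im3 y - Im3 x * Im2 y"
| "Im2 (x * y) = Re0 x * Im2 y - Im1 x * Im3 y + Im2 x * Re0 y + Im3 x * Im1 y"
| "Im3 (x * y) = Re0 x * Im3 y + Im1 x * Im2 y - Im2 x * Im1 y + Im3 x * Re0 y"

instance
proof
  fix x y z :: quat
  show "x * y * z = x * (y * z)"
    unfolding quat_eq_iff times_quat.sel by algebra
  show "(x + y) * z = x * z + y * z"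
    unfolding quat_eq_iff times_quat.sel plus_quat.sel by algebra
  show "x * (y + z) = x * y + x * z"
    unfolding quat_eq_iff times_quat.sel plus_quat.sel by algebra
qed (simp_all add: quat_eq_iff)

end

instantiation quat :: real_algebra_1
begin

primcorec scaleR_quat where
  "Re0 (r *\<^sub>R x) = r * Re0 x"
| "Im1 (r *\<^sub>R x) = r * Im1 x"
| "Im2 (r *\<^sub>R x) = r * Im2 x"
| "Im3 (r *\<^sub>R x) = r * Im3 x"

instance
  by standard (simp_all add: quat_eq_iff distrib_left distrib_right right_diff_distrib)

end

primcorec qcnj :: "quat \<Rightarrow> quat" where
  "Re0 (qcnj x) = Re0 x"
| "Im1 (qcnj x) = - Im1 x"
| "Im2 (qcnj x) = - Im2 x"
| "Im3 (qcnj x) = - Im3 x"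

instantiation quat :: real_inner
begin

definition inner_quat :: "quat \<Rightarrow> quat \<Rightarrow> real" where
  "inner x y = Re0 x * Re0 y + Im1 x * Im1 y + Im2 x * Im2 y + Im3 x * Im3 y"

definition norm_quat :: "quat \<Rightarrow> real" where
  "norm x = sqrt (inner x x)" for x :: quat

definition sgn_quat :: "quat \<Rightarrow> quat" where
  "sgn x = x /\<^sub>R norm x" for x :: quat

definition dist_quat :: "quat \<Rightarrow> quat \<Rightarrow> real" where
  "dist x y = norm (x - y)" for x y :: quat

definition uniformity_quat :: "(quat \<times> quat) filter" where
  "uniformity = (INF e\<in>{0<..}. principal {(x :: quat, y). dist x y < e})"

definition open_quat :: "quat set \<Rightarrow> bool" where
  "open U \<longleftrightarrow> (\<forall>x\<in>U. \<forall>\<^sub>F (x', y) in uniformity. x' = x \<longrightarrow> y \<in> U)" for U :: "quat set"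

instance
proof
  fix x :: quat
  show "inner x x = 0 \<longleftrightarrow> x = 0"
  proof
    assume "inner x x = 0"
    then have "(Re0 x)\<^sup>2 + (Im1 x)\<^sup>2 + ((Im2 x)\<^sup>2 + (Im3 x)\<^sup>2) = 0"
      by (simp add: inner_quat_def power2_eq_square)
    then have "(Re0 x)\<^sup>2 + (Im1 x)\<^sup>2 = 0 \<and> (Im2 x)\<^sup>2 + (Im3 x)\<^sup>2 = 0"
      by (smt (verit) zero_le_power2)
    then show "x = 0"
      by (simp add: sum_power2_eq_zero_iff quat_eq_iff)
  qed (simp add: inner_quat_def)
next
  fix x y z :: quat and r :: real
  show "inner x y = inner y x"
    by (simp add: inner_quat_def mult.commute)
  show "inner (x + y) z = inner x z + inner y z"
    by (simp add: inner_quat_def distrib_right)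
  show "inner (r *\<^sub>R x) y = r * inner x y"
    by (simp add: inner_quat_def distrib_left)
  show "0 \<le> inner x x"
    by (simp add: inner_quat_def)
qed (fact norm_quat_def sgn_quat_def dist_quat_def uniformity_quat_def open_quat_def)+

end

lemma norm_quat_mult: "norm (x * y) = norm x * norm y" for x y :: quat
proof -
  have "inner (x * y) (x * y) = inner x x * inner y y"
    unfolding inner_quat_def times_quat.sel by algebra
  then show ?thesis
    by (simp add: norm_quat_def real_sqrt_mult)
qed

lemma mult_qcnj_right: "x * qcnj x = (norm x)\<^sup>2 *\<^sub>R 1"
  by (simp add: quat_eq_iff power2_norm_eq_inner inner_quat_def)

lemma mult_qcnj_left: "qcnj x * x = (norm x)\<^sup>2 *\<^sub>R 1"
  by (simp add: quat_eq_iff power2_norm_eq_inner inner_quat_def)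

instantiation quat :: real_normed_div_algebra
begin

definition inverse_quat :: "quat \<Rightarrow> quat" where
  "inverse x = qcnj x /\<^sub>R (norm x)\<^sup>2"

definition divide_quat :: "quat \<Rightarrow> quat \<Rightarrow> quat" where
  "x div y = x * inverse y" for x y :: quat

instance
proof
  fix x y :: quat
  show "x \<noteq> 0 \<Longrightarrow> inverse x * x = 1"
    by (simp add: inverse_quat_def mult_qcnj_left)
  show "x \<noteq> 0 \<Longrightarrow> x * inverse x = 1"
    by (simp add: inverse_quat_def mult_qcnj_right)
  show "x div y = x * inverse y"
    by (rule divide_quat_def)
  show "inverse (0::quat) = 0"
    by (simp add: inverse_quat_def quat_eq_iff)
  show "norm (x * y) = norm x * norm y"
    by (rule norm_quat_mult)
qed

end

instantiation quat :: euclidean_space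
begin

definition Basis_quat :: "quat set" where
  "Basis = {Quat 1 0 0 0, Quat 0 1 0 0, Quat 0 0 1 0, Quat 0 0 0 1}"

instance
proof
  fix u v x :: quat
  show "(Basis :: quat set) \<noteq> {}" and "finite (Basis :: quat set)"
    by (simp_all add: Basis_quat_def)
  show "u \<in> Basis \<Longrightarrow> v \<in> Basis \<Longrightarrow> inner u v = (if u = v then 1 else 0)"
    unfolding Basis_quat_def by (elim insertE emptyE) (simp_all add: inner_quat_def)
  show "(\<forall>u\<in>Basis. inner x u = 0) \<longleftrightarrow> x = 0"
    unfolding Basis_quat_def ball_simps by (simp add: inner_quat_def quat_eq_iff[of x])
qed

end


section \<open>Right Hilbert spaces over the quaternions\<close>

text \<open>The space is a subset \<open>V\<close> of an ambient additive group; \<open>scale v \<lambda>\<close> is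
  \<open>v \<lambda>\<close>. Closure under negatives follows from the scalar action of \<open>- 1\<close>.\<close>

locale quat_right_space =
  fixes V :: "'v::ab_group_add set"
    and scale :: "'v \<Rightarrow> quat \<Rightarrow> 'v"
  assumes zero_closed: "0 \<in> V"
    and add_closed: "u \<in> V \<Longrightarrow> v \<in> V \<Longrightarrow> u + v \<in> V"
    and scale_closed: "v \<in> V \<Longrightarrow> scale v a \<in> V"
    and scale_add_left: "u \<in> V \<Longrightarrow> v \<in> V \<Longrightarrow> scale (u + v) a = scale u a + scale v a"
    and scale_add_right: "v \<in> V \<Longrightarrow> scale v (a + b) = scale v a + scale v b"
    and scale_scale: "v \<in> V \<Longrightarrow> scale (scale v a) b = scale v (a * b)"
    and scale_one: "v \<in> V \<Longrightarrow> scale v 1 = v"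

locale quat_right_hilbert_space = quat_right_space V scale
  for V :: "'v::ab_group_add set" and scale :: "'v \<Rightarrow> quat \<Rightarrow> 'v" +
  fixes ip :: "'v \<Rightarrow> 'v \<Rightarrow> quat"
  assumes ip_linear:
      "f \<in> V \<Longrightarrow> g \<in> V \<Longrightarrow> h \<in> V \<Longrightarrow> ip f (scale g a + h) = ip f g * a + ip f h"
    and ip_cnj: "f \<in> V \<Longrightarrow> g \<in> V \<Longrightarrow> ip g f = qcnj (ip f g)"
    and ip_nonneg: "f \<in> V \<Longrightarrow> ip f f \<in> \<real> \<and> 0 \<le> Re0 (ip f f)"
    and ip_eq_zero_iff: "f \<in> V \<Longrightarrow> ip f f = 0 \<longleftrightarrow> f = 0"
    and complete:
      "(\<And>n. X n \<in> V) \<Longrightarrow>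
       (\<And>e. e > 0 \<Longrightarrow> \<exists>N. \<forall>m\<ge>N. \<forall>n\<ge>N. sqrt (Re0 (ip (X m - X n) (X m - X n))) < e) \<Longrightarrow>
       \<exists>l\<in>V. (\<lambda>n. sqrt (Re0 (ip (X n - l) (X n - l)))) \<longlonglongrightarrow> 0"


section \<open>Slice regular functions and the Dirichlet space\<close>

definition imag_units :: "quat set" where
  "imag_units = {u. Re0 u = 0 \<and> norm u = 1}"

definition slice_point :: "quat \<Rightarrow> real \<times> real \<Rightarrow> quat" where
  "slice_point i = (\<lambda>(x, y). of_real x + i * of_real y)"

definition slice_plane :: "quat \<Rightarrow> quat set" where
  "slice_plane i = range (slice_point i)"

definition slice_ball :: "quat \<Rightarrow> quat set" where
  "slice_ball i = ball 0 1 \<inter> slice_plane i"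

text \<open>The area measure \<open>dx dy\<close> of the plane \<open>slice_plane i\<close>, as a measure on the
  quaternions concentrated on that plane.\<close>

definition slice_area :: "quat \<Rightarrow> quat measure" where
  "slice_area i = distr lborel borel (slice_point i)"

definition slice_regular :: "(quat \<Rightarrow> quat) \<Rightarrow> bool" where
  "slice_regular f \<longleftrightarrow>
     f differentiable_on ball 0 1 \<and>
     (\<forall>i\<in>imag_units. \<forall>x y. slice_point i (x, y) \<in> slice_ball i \<longrightarrow>
        vector_derivative (\<lambda>s. f (slice_point i (s, y))) (at x)
        + i * vector_derivative (\<lambda>t. f (slice_point i (x, t))) (at y) = 0)"

definition deriv_x0 :: "(quat \<Rightarrow> quat) \<Rightarrow> quat \<Rightarrow> quat" where
  "deriv_x0 f q = vector_derivative (\<lambda>t. f (q + of_real t)) (at 0)"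

text \<open>A function on the unit ball is represented by its extension by \<open>0\<close> to all
  quaternions, so that equality of functions on the ball is equality in HOL.\<close>

definition dirichlet_space :: "(quat \<Rightarrow> quat) set" where
  "dirichlet_space = {f. slice_regular f \<and> (\<forall>q. q \<notin> ball 0 1 \<longrightarrow> f q = 0) \<and>
     (SUP i\<in>imag_units.
        \<integral>\<^sup>+z\<in>slice_ball i. ennreal ((norm (deriv_x0 f z))\<^sup>2) \<partial>slice_area i) < \<infinity>}"

text \<open>The description operator denotes the value of the slice integral common to all
  imaginary units; it exists only because the integral does not depend on the unit.\<close>

definition dirichlet_inner :: "(quat \<Rightarrow> quat) \<Rightarrow> (quat \<Rightarrow> quat) \<Rightarrow> quat" where
  "dirichlet_inner f g = qcnj (f 0) * g 0 +
     (THE c. \<forall>i\<in>imag_units.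
        c = (LINT z:slice_ball i|slice_area i. qcnj (deriv_x0 f z) * deriv_x0 g z))"

end

theory Submission
  imports Defs "HOL-Complex_Analysis.Cauchy_Integral_Formula"
begin

text \<open>On each slice, composing \<open>f\<close> with the \<open>\<complex>(i)\<close>-linear functionals of the quaternions gives
  holomorphic functions on the disc, so \<open>f\<close> is a power series \<open>\<Sum> q\<^sup>n a\<^sub>n\<close> there; the coefficients are
  determined by the values on the real axis and hence do not depend on the slice. Distinct
  monomials are orthogonal on a disc by rotation invariance, so
  \<open>\<parallel>f\<parallel>\<^sup>2 = \<bar>a\<^sub>0\<bar>\<^sup>2 + \<Sum> (n + 1)\<^sup>2 \<mu>\<^sub>n \<bar>a\<^sub>n\<^sub>+\<^sub>1\<bar>\<^sup>2\<close> with \<open>\<mu>\<^sub>n\<close> the integral of \<open>\<bar>z\<bar>\<^sup>2\<^sup>n\<close> over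
  the unit disc. Hence the energy is independent of the slice, and so is the pairing by polarization.
  Since \<open>\<mu>\<^sub>n \<ge> c r\<^sup>2\<^sup>n\<close> for every \<open>r < 1\<close>, every sequence of finite weighted norm is the
  coefficient sequence of a function in the space, and completeness is that of a weighted
  \<open>\<ell>\<^sup>2\<close> space.\<close>

section \<open>Power series expansion of slice regular functions\<close>

text \<open>Noncommutativity shapes the argument. The differential of \<open>q ^ n\<close> in a
  direction h is the sum of the terms q^k h q^(n-1-k), which collapses to n h q^(n-1) when h
  commutes with q. The directions 1 and i do so at points of the slice of i, and in these directions
  slice regularity and \<open>deriv_x0\<close> are tested. Coefficients stand on the right, where
  right scalars act on them directly and left multiplication by elements of a slice does not disturb
  them. The values of f are not split into two complex components; all functionals are used at once.
  The series is uniformly controlled on discs of radius r < 1, so Parseval's identity is obtained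
  there and carried to the unit disc by monotone exhaustion, in extended nonnegative reals so that
  infinite energy is no separate case. The description operator in \<open>dirichlet_inner\<close>
  acquires a value only once the pairing is known to be independent of the slice, so linearity,
  symmetry and the norm formula are first proved for the integral over one fixed slice.\<close>

text \<open>Once the lower coefficients vanish, the series can be divided by \<open>t ^ n\<close>,
  and letting t tend to 0 isolates \<open>c n\<close>. Every comparison of coefficients below is
  reduced to this real case.\<close>

lemma real_powser_zero_unique:
  fixes c :: "nat \<Rightarrow> real"
  assumes "\<And>t. \<lbrakk>t \<noteq> 0; \<bar>t\<bar> < 1\<rbrakk> \<Longrightarrow> (\<lambda>n. c n * t ^ n) sums 0"
  shows "c n = 0"
proof (induction n rule: less_induct)
  case (less n)
  have "((\<lambda>t::real. 0::real) \<longlongrightarrow> c (0 + n)) (at 0)"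
  proof (rule powser_limit_0_strong[where a = "\<lambda>m. c (m + n)" and s = 1])
    fix t :: real
    assume t: "t \<noteq> 0" "norm t < 1"
    then have "(\<lambda>m. c m * t ^ m) sums 0"
      using assms by simp
    moreover have "(\<Sum>m<n. c m * t ^ m) = 0"
      using less by simp
    ultimately have "(\<lambda>m. c (m + n) * t ^ (m + n)) sums 0"
      by (subst sums_iff_shift) simp
    then have "(\<lambda>m. c (m + n) * t ^ (m + n) / t ^ n) sums (0 / t ^ n)"
      by (rule sums_divide)
    then show "(\<lambda>m. c (m + n) * t ^ m) sums 0"
      using t by (simp add: power_add)
  qed simp
  then show ?case
    by (simp add: tendsto_const_iff)
qed

lemma sums_componentwise_inner:
  fixes f :: "nat \<Rightarrow> 'a::euclidean_space"
  assumes "\<And>u. (\<lambda>n. inner u (f n)) sums inner u l"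
  shows "f sums l"
proof -
  have "((\<lambda>n. inner (sum f {..<n}) b) \<longlonglongrightarrow> inner l b)" for b
    using assms[of b] by (simp add: sums_def inner_sum_right inner_commute[of _ b])
  then show ?thesis
    unfolding sums_def by (subst tendsto_componentwise_iff) auto
qed

lemma inner_quat_mult_left_unit:
  fixes u p q :: quat
  assumes "norm u = 1"
  shows "inner (u * p) (u * q) = inner p q"
proof -
  have "inner u u = 1"
    using assms by (simp add: norm_eq_1)
  moreover have "inner (u * p) (u * q) = inner u u * inner p q"
    unfolding inner_quat_def times_quat.sel by algebra
  ultimately show ?thesis
    by simp
qed

section \<open>Slices as copies of the complex plane\<close>

lemma imag_unitsD:
  assumes "i \<in> imag_units"
  shows "Re0 i = 0" "Im1 i * Im1 i + Im2 i * Im2 i + Im3 i * Im3 i = 1"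
proof -
  show *: "Re0 i = 0"
    using assms by (simp add: imag_units_def)
  show "Im1 i * Im1 i + Im2 i * Im2 i + Im3 i * Im3 i = 1"
    using assms * by (auto simp: imag_units_def norm_eq_1 inner_quat_def)
qed

lemma imag_units_square:
  assumes "i \<in> imag_units"
  shows "i * i = - 1"
  using imag_unitsD[OF assms] by (simp add: quat_eq_iff algebra_simps)

text \<open>Takes a complex number rather than a pair: for an imaginary unit \<open>i\<close> this
  is the ring embedding of the complex field sending \<open>\<i>\<close> to \<open>i\<close>, so
  products and powers within a slice can be computed in the complex numbers.\<close>

definition slice_embed :: "quat \<Rightarrow> complex \<Rightarrow> quat" where
  "slice_embed i z = slice_point i (Re z, Im z)"

lemma slice_embed_alt: "slice_embed i z = of_real (Re z) + i * of_real (Im z)"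
  by (simp add: slice_embed_def slice_point_def)

lemma slice_point_eq_embed: "slice_point i (x, y) = slice_embed i (Complex x y)"
  by (simp add: slice_embed_def)

lemma of_real_quat_sel [simp]:
  "Re0 (of_real r) = r" "Im1 (of_real r) = 0" "Im2 (of_real r) = 0" "Im3 (of_real r) = 0"
  by (simp_all add: of_real_def)

lemma slice_embed_of_real [simp]: "slice_embed i (of_real r) = of_real r"
  by (simp add: slice_embed_alt)

lemma slice_embed_1 [simp]: "slice_embed i 1 = 1"
  by (simp add: slice_embed_alt)

lemma slice_embed_ii [simp]: "slice_embed i \<i> = i"
  by (simp add: slice_embed_alt)

lemma slice_embed_mult:
  assumes "i \<in> imag_units"
  shows "slice_embed i (z * w) = slice_embed i z * slice_embed i w"
proof -
  show ?thesis
    by (simp add: slice_embed_alt algebra_simps of_real_def imag_units_square[OF assms])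
qed

lemma slice_embed_power:
  assumes "i \<in> imag_units"
  shows "slice_embed i (z ^ n) = slice_embed i z ^ n"
  by (induction n) (simp_all add: slice_embed_mult[OF assms])

lemma norm_slice_embed:
  assumes "i \<in> imag_units"
  shows "norm (slice_embed i z) = norm z"
proof -
  have "(Im1 i)\<^sup>2 + (Im2 i)\<^sup>2 + (Im3 i)\<^sup>2 = 1" "Re0 i = 0"
    using imag_unitsD[OF assms] by (simp_all add: power2_eq_square)
  then have "inner (slice_embed i z) (slice_embed i z) = (Re z)\<^sup>2 + (Im z)\<^sup>2"
    unfolding slice_embed_alt inner_quat_def by simp algebra
  then show ?thesis
    by (simp add: norm_quat_def cmod_def)
qed

lemma bounded_linear_slice_embed: "bounded_linear (slice_embed i)"
  unfolding slice_embed_alt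
  by (intro bounded_linear_add bounded_linear_mult_const bounded_linear_const_mult
      bounded_linear_compose[OF bounded_linear_of_real] bounded_linear_Re bounded_linear_Im)

lemma imag_units_nonempty: "Quat 0 1 0 0 \<in> imag_units"
  by (simp add: imag_units_def norm_eq_1 inner_quat_def)

text \<open>The unit is the normalized imaginary part of \<open>q\<close>. A real quaternion lies in
  every slice, and a fixed unit is chosen for it.\<close>

lemma quat_in_some_slice:
  obtains i z where "i \<in> imag_units" "q = slice_embed i z"
proof -
  define v where "v = Quat 0 (Im1 q) (Im2 q) (Im3 q)"
  have q: "q = of_real (Re0 q) + v"
    by (simp add: quat_eq_iff v_def)
  show ?thesis
  proof (cases "v = 0")
    case True
    with q show ?thesis
      by (intro that[OF imag_units_nonempty, of "of_real (Re0 q)"]) simp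
  next
    case False
    then have "sgn v \<in> imag_units"
      by (simp add: imag_units_def norm_sgn sgn_div_norm v_def)
    moreover have "v = sgn v * of_real (norm v)"
      using False by (simp add: of_real_def sgn_div_norm)
    then have "q = slice_embed (sgn v) (Complex (Re0 q) (norm v))"
      using q by (simp add: slice_embed_alt)
    ultimately show ?thesis
      by (rule that)
  qed
qed

text \<open>For an imaginary unit \<open>i\<close>, the functional with real part \<open>inner u\<close> that is complex linear for
  left multiplication by \<open>\<complex>(i)\<close>.\<close>

definition slice_functional :: "quat \<Rightarrow> quat \<Rightarrow> quat \<Rightarrow> complex" where
  "slice_functional i u q = Complex (inner u q) (- inner u (i * q))"

lemma bounded_linear_slice_functional: "bounded_linear (slice_functional i u)"
proof -
  have "bounded_linear (\<lambda>q. of_real (inner u q) + \<i> * of_real (- inner u (i * q)))"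
    by (intro bounded_linear_add bounded_linear_const_mult bounded_linear_minus
        bounded_linear_compose[OF bounded_linear_of_real]
        bounded_linear_compose[OF bounded_linear_inner_right] bounded_linear_mult_right
        bounded_linear_inner_right)
  then show ?thesis
    by (simp add: slice_functional_def[abs_def] complex_eq_iff Complex_eq)
qed

lemma slice_functional_mult:
  assumes "i \<in> imag_units"
  shows "slice_functional i u (slice_embed i z * q) = z * slice_functional i u q"
proof -
  have i: "i * (i * p) = - p" for p
    using imag_units_square[OF assms] by (simp flip: mult.assoc)
  show ?thesis
    by (simp add: slice_functional_def slice_embed_alt complex_eq_iff of_real_def
        inner_add_right algebra_simps i)
qed

text \<open>The slice equation says that the real differential D satisfies D i = i D 1. Along the
  slice it is therefore left multiplication of D 1 by the increment, which the functional turns into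
  complex multiplication; this is complex differentiability.\<close>

lemma slice_regular_functional_holomorphic:
  assumes f: "slice_regular f" and i: "i \<in> imag_units"
  shows "(\<lambda>z. slice_functional i u (f (slice_embed i z))) holomorphic_on ball 0 1"
proof (rule holomorphic_onI)
  fix z :: complex
  assume z: "z \<in> ball 0 1"
  let ?q = "slice_embed i z"
  have q: "?q \<in> ball 0 1"
    using z by (simp add: norm_slice_embed[OF i])
  then have "f differentiable at ?q"
    using f differentiable_on_eq_differentiable_at[OF open_ball, of f 0 1]
    by (auto simp: slice_regular_def)
  then obtain D where D: "(f has_derivative D) (at ?q)"
    by (auto simp: differentiable_def)
  then interpret D: bounded_linear D
    by (rule has_derivative_bounded_linear)
  have D': "(f has_derivative D) (at (of_real (Re z) + i * of_real (Im z)))"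
    using D by (simp add: slice_embed_alt)
  have "((\<lambda>s. f (slice_point i (s, Im z))) has_derivative (\<lambda>h. D (of_real h))) (at (Re z))"
    by (rule has_derivative_compose[of "\<lambda>s. slice_point i (s, Im z)" of_real, where g = f and g' = D])
      (auto simp: slice_point_def D'
        intro!: derivative_eq_intros)
  then have 1: "((\<lambda>s. f (slice_point i (s, Im z))) has_vector_derivative D 1) (at (Re z))"
    by (simp add: has_vector_derivative_def of_real_def D.scaleR)
  have "((\<lambda>t. f (slice_point i (Re z, t))) has_derivative (\<lambda>h. D (i * of_real h))) (at (Im z))"
    by (rule has_derivative_compose[of "\<lambda>t. slice_point i (Re z, t)" "\<lambda>h. i * of_real h", where g = f and g' = D])
      (auto simp: slice_point_def D'
        intro!: derivative_eq_intros)
  then have 2: "((\<lambda>t. f (slice_point i (Re z, t))) has_vector_derivative D i) (at (Im z))"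
    by (simp add: has_vector_derivative_def of_real_def D.scaleR)
  have "slice_point i (Re z, Im z) \<in> slice_ball i"
    using q by (simp add: slice_ball_def slice_plane_def slice_embed_def)
  then have "D 1 + i * D i = 0"
    using f i 1 2 unfolding slice_regular_def
    by (metis vector_derivative_at)
  \<comment> \<open>Multiplying the slice equation by \<open>i\<close> on the left and using
    \<open>i * i = - 1\<close> solves it for \<open>D i\<close>.\<close>
  then have "i * D 1 + i * (i * D i) = 0"
    by (metis distrib_left mult_zero_right)
  then have Di: "D i = i * D 1"
    using imag_units_square[OF i] by (simp flip: mult.assoc)
  have D_embed: "D (slice_embed i w) = slice_embed i w * D 1" for w
  proof -
    have "slice_embed i w = Re w *\<^sub>R 1 + Im w *\<^sub>R i"
      by (simp add: slice_embed_alt of_real_def)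
    then show ?thesis
      by (simp add: D.add D.scaleR Di distrib_right)
  qed
  have "((\<lambda>z. f (slice_embed i z)) has_derivative (\<lambda>w. D (slice_embed i w))) (at z)"
    by (rule has_derivative_compose[OF bounded_linear_imp_has_derivative[OF bounded_linear_slice_embed] D])
  then have "((\<lambda>z. slice_functional i u (f (slice_embed i z))) has_derivative
      (\<lambda>w. slice_functional i u (D (slice_embed i w)))) (at z)"
    by (rule bounded_linear.has_derivative[OF bounded_linear_slice_functional])
  then have "((\<lambda>z. slice_functional i u (f (slice_embed i z))) has_field_derivative
      slice_functional i u (D 1)) (at z)"
    unfolding has_field_derivative_def D_embed slice_functional_mult[OF i]
    by (metis (no_types, lifting) has_derivative_eq_rhs ext mult.commute)
  then show "(\<lambda>z. slice_functional i u (f (slice_embed i z))) field_differentiable at z within ball 0 1"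
    using field_differentiable_at_within field_differentiable_def by blast
qed

text \<open>One coefficient sequence serves the whole four-dimensional ball. The coefficients are on
  the right because \<open>i\<close> commutes with powers of points of its slice but not with the
  coefficients.\<close>

definition has_power_series :: "(quat \<Rightarrow> quat) \<Rightarrow> (nat \<Rightarrow> quat) \<Rightarrow> bool" where
  "has_power_series f a \<longleftrightarrow> (\<forall>q\<in>ball 0 1. (\<lambda>n. q ^ n * a n) sums f q)"

text \<open>On the real axis the powers are real scalars, so \<open>inner u\<close> passes through
  them and the real uniqueness lemma applies for every \<open>u\<close>. The real axis is common to
  all slices, which is how expansions on different slices are identified.\<close>

lemma real_quat_powser_unique:
  fixes a b :: "nat \<Rightarrow> quat"
  assumes "\<And>t::real. \<bar>t\<bar> < 1 \<Longrightarrow> (\<lambda>n. of_real t ^ n * a n) sums f t"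
    and "\<And>t::real. \<bar>t\<bar> < 1 \<Longrightarrow> (\<lambda>n. of_real t ^ n * b n) sums f t"
  shows "a = b"
proof
  fix n
  have "inner u (a n - b n) = 0" for u
  proof (rule real_powser_zero_unique[where c = "\<lambda>n. inner u (a n - b n)"])
    fix t :: real
    assume t: "\<bar>t\<bar> < 1"
    have "(\<lambda>n. of_real t ^ n * a n - of_real t ^ n * b n) sums (f t - f t)"
      by (intro sums_diff assms t)
    then have "(\<lambda>n. inner u (of_real t ^ n * a n - of_real t ^ n * b n)) sums inner u 0"
      by (intro bounded_linear.sums[OF bounded_linear_inner_right]) simp
    then show "(\<lambda>n. inner u (a n - b n) * t ^ n) sums 0"
      by (simp add: of_real_def scaleR_power inner_diff_right algebra_simps flip: of_real_power)
  qed
  then have "a n - b n = 0"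
    using inner_eq_zero_iff by blast
  then show "a n = b n"
    by simp
qed

text \<open>Each functional of f has a complex Taylor expansion with coefficients
  \<open>c u n\<close>. What must be shown is that, for fixed n, these numbers are the functionals
  of a single quaternion \<open>a n\<close>. Both sides are compared on the real axis, and then the
  expansion extends to the slice by complex linearity.\<close>

lemma slice_regular_slice_power_series:
  assumes f: "slice_regular f" and i: "i \<in> imag_units"
  obtains a where "\<And>z. norm z < 1 \<Longrightarrow> (\<lambda>n. slice_embed i z ^ n * a n) sums f (slice_embed i z)"
proof -
  define g where "g u z = slice_functional i u (f (slice_embed i z))" for u z
  define c where "c u n = (deriv ^^ n) (g u) 0 / fact n" for u n
  \<comment> \<open>The real part of \<open>slice_functional i u q\<close> is
    \<open>inner u q\<close>, so the coordinates of the wanted coefficient can only be the real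
    parts of \<open>c b n\<close> for basis vectors \<open>b\<close>.\<close>
  define a where "a n = (\<Sum>b\<in>Basis. Re (c b n) *\<^sub>R b)" for n
  have g_sums: "(\<lambda>n. c u n * z ^ n) sums g u z" if "norm z < 1" for u and z :: complex
    using holomorphic_power_series[OF slice_regular_functional_holomorphic[OF f i, of u], of z] that
    by (simp add: c_def g_def[abs_def])
  have Re_c: "(\<lambda>n. Re (c u n) * t ^ n) sums inner u (f (of_real t))" if "\<bar>t\<bar> < 1" for u and t :: real
    using sums_Re[OF g_sums[of "of_real t" u]] that
    by (simp add: g_def slice_functional_def flip: of_real_power)
  have Im_c: "(\<lambda>n. Im (c u n) * t ^ n) sums (- inner u (i * f (of_real t)))" if "\<bar>t\<bar> < 1" for u and t :: real
    using sums_Im[OF g_sums[of "of_real t" u]] that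
    by (simp add: g_def slice_functional_def flip: of_real_power)
  have real_sums: "(\<lambda>n. of_real t ^ n * a n) sums f (of_real t)" if t: "\<bar>t\<bar> < 1" for t :: real
  proof -
    have "(\<lambda>n. \<Sum>b\<in>Basis. (Re (c b n) * t ^ n) *\<^sub>R b) sums (\<Sum>b\<in>Basis. inner b (f (of_real t)) *\<^sub>R b)"
      by (intro sums_sum bounded_linear.sums[OF bounded_linear_scaleR_left] Re_c t)
    moreover have "(\<Sum>b\<in>Basis. (Re (c b n) * t ^ n) *\<^sub>R b) = of_real t ^ n * a n" for n
      by (simp add: a_def of_real_def scaleR_sum_right mult.commute flip: of_real_power)
    moreover have "(\<Sum>b\<in>Basis. inner b (f (of_real t)) *\<^sub>R b) = f (of_real t)"
      by (simp add: inner_commute[of _ "f _"] euclidean_representation)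
    ultimately show ?thesis
      by simp
  qed
  have Re_c_eq: "inner u (a n) = Re (c u n)" for u n
  proof -
    have "inner u (a n) - Re (c u n) = 0"
    proof (rule real_powser_zero_unique[where c = "\<lambda>n. inner u (a n) - Re (c u n)"])
      fix t :: real
      assume t: "\<bar>t\<bar> < 1"
      have "(\<lambda>n. inner u (of_real t ^ n * a n)) sums inner u (f (of_real t))"
        by (intro bounded_linear.sums[OF bounded_linear_inner_right] real_sums t)
      from sums_diff[OF this Re_c[OF t, of u]]
      show "(\<lambda>n. (inner u (a n) - Re (c u n)) * t ^ n) sums 0"
        by (simp add: of_real_def algebra_simps flip: of_real_power)
    qed
    then show ?thesis by simp
  qed
  \<comment> \<open>The imaginary parts did not enter the construction of \<open>a\<close>; their
    agreement again comes from the expansion of f on the real axis, now multiplied by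
    \<open>i\<close> on the left.\<close>
  have Im_c_eq: "- inner u (i * a n) = Im (c u n)" for u n
  proof -
    have "- inner u (i * a n) - Im (c u n) = 0"
    proof (rule real_powser_zero_unique[where c = "\<lambda>n. - inner u (i * a n) - Im (c u n)"])
      fix t :: real
      assume t: "\<bar>t\<bar> < 1"
      have "(\<lambda>n. - inner u (i * (of_real t ^ n * a n))) sums (- inner u (i * f (of_real t)))"
        by (intro sums_minus bounded_linear.sums[OF bounded_linear_inner_right]
            bounded_linear.sums[OF bounded_linear_mult_right] real_sums t)
      from sums_diff[OF this Im_c[OF t, of u]]
      show "(\<lambda>n. (- inner u (i * a n) - Im (c u n)) * t ^ n) sums 0"
        by (simp add: of_real_def algebra_simps flip: of_real_power)
    qed
    then show ?thesis by simp
  qed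
  have L_a: "slice_functional i u (a n) = c u n" for u n
    by (simp add: slice_functional_def complex_eq_iff Re_c_eq Im_c_eq)
  show ?thesis
  proof (rule that[of a], rule sums_componentwise_inner)
    fix z :: complex and u :: quat
    assume "norm z < 1"
    have "c u n * z ^ n = slice_functional i u (slice_embed i z ^ n * a n)" for n
      by (simp add: slice_functional_mult[OF i] L_a flip: slice_embed_power[OF i])
    then have "(\<lambda>n. Re (slice_functional i u (slice_embed i z ^ n * a n))) sums Re (g u z)"
      using sums_Re[OF g_sums[OF \<open>norm z < 1\<close>, of u]] by simp
    then show "(\<lambda>n. inner u (slice_embed i z ^ n * a n)) sums inner u (f (slice_embed i z))"
      by (simp add: g_def slice_functional_def)
  qed
qed

theorem slice_regular_has_power_series:
  assumes f: "slice_regular f"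
  obtains a where "has_power_series f a"
proof -
  define is_coeffs where "is_coeffs i a \<longleftrightarrow>
    (\<forall>z. norm z < 1 \<longrightarrow> (\<lambda>n. slice_embed i z ^ n * a n) sums f (slice_embed i z))" for i a
  have ex: "\<exists>a. is_coeffs i a" if i: "i \<in> imag_units" for i
    using slice_regular_slice_power_series[OF f i] unfolding is_coeffs_def by metis
  then obtain a where a: "is_coeffs (Quat 0 1 0 0) a"
    using imag_units_nonempty by blast
  have real: "(\<lambda>n. of_real t ^ n * b n) sums f (of_real t)" if "is_coeffs i b" "\<bar>t\<bar> < 1" for i b t
    using that unfolding is_coeffs_def
    by (metis norm_of_real slice_embed_of_real real_norm_def)
  show ?thesis
  proof (rule that[of a], unfold has_power_series_def, intro ballI)
    fix q :: quat
    assume q: "q \<in> ball 0 1"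
    obtain i z where i: "i \<in> imag_units" and z: "q = slice_embed i z"
      by (rule quat_in_some_slice)
    obtain b where b: "is_coeffs i b"
      using ex[OF i] by blast
    have "b = a"
      by (rule real_quat_powser_unique[where f = "\<lambda>t. f (of_real t)"]) (use real a b in auto)
    then show "(\<lambda>n. q ^ n * a n) sums f q"
      using b q z by (simp add: is_coeffs_def norm_slice_embed[OF i])
  qed
qed

section \<open>Derivatives of quaternionic power series\<close>

text \<open>The differential of \<open>q ^ n\<close> in the direction \<open>h\<close>, that is the
  sum of q^k h q^(n-1-k) for k < n. The recursion is the product rule for
  \<open>q * q ^ n\<close>.\<close>

primrec power_deriv :: "nat \<Rightarrow> 'a::real_normed_algebra_1 \<Rightarrow> 'a \<Rightarrow> 'a" where
  "power_deriv 0 q h = 0"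
| "power_deriv (Suc n) q h = h * q ^ n + q * power_deriv n q h"

lemma has_derivative_power_deriv:
  "((\<lambda>q::'a::real_normed_algebra_1. q ^ n) has_derivative power_deriv n q) (at q within S)"
proof (induction n)
  case 0
  then show ?case
    by (simp add: power_deriv.simps(1)[abs_def])
next
  case (Suc n)
  have "((\<lambda>q. q * q ^ n) has_derivative (\<lambda>h. q * power_deriv n q h + h * q ^ n)) (at q within S)"
    by (rule has_derivative_mult[OF has_derivative_ident Suc])
  then show ?case
    by (simp add: power_deriv.simps(2)[abs_def] add.commute)
qed

lemma norm_power_deriv_Suc_le:
  "norm (power_deriv (Suc n) q h) \<le> of_nat (Suc n) * norm q ^ n * norm h"
proof (induction n)
  case 0
  then show ?case by simp
next
  case (Suc n)
  have "norm (h * q ^ Suc n) \<le> norm h * norm q ^ Suc n"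
    by (meson norm_mult_ineq norm_power_ineq mult_left_mono norm_ge_zero order_trans)
  moreover have "norm (q * power_deriv (Suc n) q h) \<le> norm q * (of_nat (Suc n) * norm q ^ n * norm h)"
    by (meson Suc norm_mult_ineq mult_left_mono norm_ge_zero order_trans)
  ultimately have "norm (h * q ^ Suc n + q * power_deriv (Suc n) q h)
      \<le> norm h * norm q ^ Suc n + norm q * (of_nat (Suc n) * norm q ^ n * norm h)"
    by (rule norm_triangle_mono)
  then show ?case
    by (simp only: power_deriv.simps) (simp add: algebra_simps)
qed

text \<open>All summands of the differential coincide once \<open>h\<close> can be moved past
  \<open>q\<close>. This is applied with \<open>h\<close> equal to 1 and to the imaginary unit of
  the slice.\<close>

lemma power_deriv_commute:
  assumes "q * h = h * q"
  shows "power_deriv (Suc n) q h = of_nat (Suc n) * (h * q ^ n)"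
proof (induction n)
  case 0
  then show ?case by simp
next
  case (Suc n)
  have "power_deriv (Suc (Suc n)) q h = h * q ^ Suc n + q * (of_nat (Suc n) * (h * q ^ n))"
    by (simp only: power_deriv.simps(2)[of "Suc n"] Suc)
  also have "q * (of_nat (Suc n) * (h * q ^ n)) = of_nat (Suc n) * (h * q ^ Suc n)"
  proof -
    have "q * (of_nat (Suc n) * (h * q ^ n)) = (q * of_nat (Suc n)) * h * q ^ n"
      by (simp only: mult.assoc)
    also have "\<dots> = of_nat (Suc n) * (q * h) * q ^ n"
      by (simp only: mult_of_nat_commute[symmetric] mult.assoc)
    finally show ?thesis
      by (simp only: assms power_Suc mult.assoc)
  qed
  finally show ?case
    by (simp add: algebra_simps)
qed

text \<open>Convergence at a real point s strictly between r and 1 makes the terms there bounded,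
  and Abel's lemma yields absolute summability at the smaller radius.\<close>

lemma has_power_series_summable:
  assumes "has_power_series f a" "0 \<le> r" "r < 1"
  shows "summable (\<lambda>n. norm (a n) * r ^ n)"
proof -
  define s where "s = (r + 1) / 2"
  have s: "r < s" "s < 1" "0 \<le> s"
    using assms by (simp_all add: s_def)
  have "(\<lambda>n. of_real s ^ n * a n) sums f (of_real s)"
    using assms s unfolding has_power_series_def by simp
  then have "(\<lambda>n. of_real s ^ n * a n) \<longlonglongrightarrow> 0"
    using sums_summable summable_LIMSEQ_zero by blast
  then have "Bseq (\<lambda>n. of_real s ^ n * a n)"
    using convergentI convergent_imp_Bseq by blast
  then obtain M where "\<And>n. norm (of_real s ^ n * a n) \<le> M"
    unfolding Bseq_def by blast
  then have "norm (a n) * s ^ n \<le> M" for n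
    using s by (simp add: norm_mult norm_power mult.commute)
  then show ?thesis
    using Abel_lemma assms(2) s(1) by blast
qed

lemma summable_imp_powser_summable:
  fixes q :: quat
  assumes "\<And>r. \<lbrakk>0 \<le> r; r < 1\<rbrakk> \<Longrightarrow> summable (\<lambda>n. norm (a n) * r ^ n)" "norm q < 1"
  shows "summable (\<lambda>n. q ^ n * a n)"
  using assms(1)[of "norm q"] assms(2)
  by - (rule summable_norm_cancel, simp add: norm_mult norm_power mult.commute)

text \<open>Termwise differentiation in all four real directions: on a ball of radius r < 1
  containing \<open>q\<close>, the differentials of the terms have a summable majorant that is
  uniform in the point and linear in the norm of the direction.\<close>

lemma has_power_series_has_derivative:
  assumes f: "has_power_series f a" and q: "q \<in> ball 0 1"
  shows "(f has_derivative (\<lambda>h. \<Sum>n. power_deriv n q h * a n)) (at q)"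
    and "summable (\<lambda>n. power_deriv n q h * a n)"
proof -
  define r where "r = (norm q + 1) / 2"
  have r: "norm q < r" "0 < r" "r < 1"
    using q by (simp_all add: r_def add_nonneg_pos)
  \<comment> \<open>Bounds the operator norm of the n-th differential on the ball of radius r. At n
    = 0 the factor \<open>real n\<close> is 0, so the truncated exponent is harmless. Summability
    holds because formal differentiation preserves the radius of convergence of the series of
    norms.\<close>
  define b where "b n = real n * norm (a n) * r ^ (n - 1)" for n
  have "summable (\<lambda>n. diffs (\<lambda>n. norm (a n)) n * r ^ n)"
  proof (rule termdiff_converges[where K = 1])
    fix x :: real
    assume "norm x < 1"
    then have "summable (\<lambda>n. norm (a n) * norm x ^ n)"
      by (intro has_power_series_summable[OF f]) auto
    then show "summable (\<lambda>n. norm (a n) * x ^ n)"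
      by - (rule summable_norm_cancel, simp add: abs_mult power_abs)
  qed (use r in simp)
  then have "summable (\<lambda>n. b (Suc n))"
    by (simp add: b_def diffs_def mult.assoc)
  then have b: "summable b"
    by (subst (asm) summable_Suc_iff)
  have bound: "norm (power_deriv n x h * a n) \<le> b n * norm h" if "x \<in> ball 0 r" for n x h
  proof (cases n)
    case (Suc m)
    have "norm (power_deriv n x h * a n) \<le> (of_nat (Suc m) * norm x ^ m * norm h) * norm (a n)"
      unfolding norm_mult Suc by (intro mult_right_mono norm_power_deriv_Suc_le) simp
    also have "\<dots> \<le> (of_nat (Suc m) * r ^ m * norm h) * norm (a n)"
      using that by (intro mult_right_mono mult_left_mono power_mono) auto
    finally show ?thesis
      by (simp add: b_def Suc mult_ac)
  qed (simp add: b_def)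
  have summ: "summable (\<lambda>n. norm (power_deriv n x h * a n))" if "x \<in> ball 0 r" for x h
    by (rule summable_comparison_test'[OF summable_mult2[OF b, of "norm h"]])
      (use bound[OF that] in simp)
  show "summable (\<lambda>n. power_deriv n q h * a n)"
    using summ[of q] r by - (rule summable_norm_cancel, simp)
  have "\<exists>g. \<forall>x\<in>ball 0 r. (\<lambda>n. x ^ n * a n) sums g x \<and>
      (g has_derivative (\<lambda>h. \<Sum>n. power_deriv n x h * a n)) (at x within ball 0 r)"
  proof (rule has_derivative_series)
    show "((\<lambda>x. x ^ n * a n) has_derivative (\<lambda>h. power_deriv n x h * a n)) (at x within ball 0 r)" for n x
      by (rule bounded_linear.has_derivative[OF bounded_linear_mult_left has_derivative_power_deriv])
    show "(\<lambda>n. q ^ n * a n) sums f q"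
      using f q by (simp add: has_power_series_def)
    fix e :: real
    assume "e > 0"
    then obtain N where N: "\<And>n. n \<ge> N \<Longrightarrow> norm (\<Sum>i. b (i + n)) < e"
      using suminf_exist_split[OF _ b] by blast
    have "norm ((\<Sum>i<n. power_deriv i x h * a i) - (\<Sum>i. power_deriv i x h * a i)) \<le> e * norm h"
      if n: "n \<ge> N" and x: "x \<in> ball 0 r" for n x h
    proof -
      have "(\<Sum>i. power_deriv i x h * a i) - (\<Sum>i<n. power_deriv i x h * a i)
          = (\<Sum>i. power_deriv (i + n) x h * a (i + n))"
        using suminf_minus_initial_segment[OF summable_norm_cancel[OF summ[OF x, of h]], of n] by simp
      then have "norm ((\<Sum>i<n. power_deriv i x h * a i) - (\<Sum>i. power_deriv i x h * a i))
          = norm (\<Sum>i. power_deriv (i + n) x h * a (i + n))"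
        by (subst norm_minus_commute) simp
      also have "\<dots> \<le> (\<Sum>i. b (i + n) * norm h)"
        by (rule norm_suminf_le[OF bound[OF x] summable_mult2[OF summable_ignore_initial_segment[OF b]]])
      also have "\<dots> = (\<Sum>i. b (i + n)) * norm h"
        by (rule suminf_mult2[OF summable_ignore_initial_segment[OF b], symmetric])
      also have "\<dots> \<le> e * norm h"
        using N[OF n] by (intro mult_right_mono) auto
      finally show ?thesis .
    qed
    then show "\<forall>\<^sub>F n in sequentially. \<forall>x\<in>ball 0 r. \<forall>h.
        norm ((\<Sum>i<n. power_deriv i x h * a i) - (\<Sum>i. power_deriv i x h * a i)) \<le> e * norm h"
      using eventually_sequentially by blast
  qed (use r in auto)
  then obtain g where g: "\<And>x. x \<in> ball 0 r \<Longrightarrow> (\<lambda>n. x ^ n * a n) sums g x"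
      "\<And>x. x \<in> ball 0 r \<Longrightarrow>
        (g has_derivative (\<lambda>h. \<Sum>n. power_deriv n x h * a n)) (at x within ball 0 r)"
    by blast
  have fg: "f x = g x" if "x \<in> ball 0 r" for x
    using g(1)[OF that] f that r by (auto simp: has_power_series_def intro: sums_unique2)
  have "(g has_derivative (\<lambda>h. \<Sum>n. power_deriv n q h * a n)) (at q)"
    using g(2)[of q] r by (simp add: at_within_open[of q "ball 0 r"])
  then show "(f has_derivative (\<lambda>h. \<Sum>n. power_deriv n q h * a n)) (at q)"
    by (rule has_derivative_transform_within_open[where s = "ball 0 r"]) (use r fg in auto)
qed

lemma slice_embed_commute:
  assumes "i \<in> imag_units"
  shows "slice_embed i z * slice_embed i w = slice_embed i w * slice_embed i z"
  by (metis assms mult.commute slice_embed_mult)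

text \<open>The coefficients of \<open>deriv_x0 f\<close> when f has the coefficients
  \<open>a\<close>.\<close>

definition shift_coeffs :: "(nat \<Rightarrow> quat) \<Rightarrow> nat \<Rightarrow> quat" where
  "shift_coeffs a n = of_nat (Suc n) * a (Suc n)"

text \<open>The term of index 0 has zero differential, so the series starts one step later;
  commutation lets \<open>h\<close> be pulled out to the left of every term.\<close>

lemma power_deriv_suminf_commute:
  assumes f: "has_power_series f a" and q: "q \<in> ball 0 1" and comm: "q * h = h * q"
  shows "(\<lambda>n. h * (q ^ n * shift_coeffs a n)) sums (\<Sum>n. power_deriv n q h * a n)"
proof -
  have "(\<lambda>n. power_deriv (Suc n) q h * a (Suc n)) sums (\<Sum>n. power_deriv n q h * a n)"
    using summable_sums[OF has_power_series_has_derivative(2)[OF f q, of h]]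
    by (subst sums_Suc_iff) simp
  moreover have "power_deriv (Suc n) q h * a (Suc n) = h * (q ^ n * shift_coeffs a n)" for n
  proof -
    have "power_deriv (Suc n) q h * a (Suc n) = of_nat (Suc n) * (h * q ^ n) * a (Suc n)"
      by (simp only: power_deriv_commute[OF comm])
    also have "of_nat (Suc n) * (h * q ^ n) = h * q ^ n * of_nat (Suc n)"
      by (rule mult_of_nat_commute)
    finally show ?thesis
      by (simp only: shift_coeffs_def mult.assoc)
  qed
  ultimately show ?thesis
    by simp
qed

lemma has_power_series_deriv_x0:
  assumes f: "has_power_series f a"
  shows "has_power_series (deriv_x0 f) (shift_coeffs a)"
  unfolding has_power_series_def
proof
  fix q :: quat
  assume q: "q \<in> ball 0 1"
  let ?D = "\<lambda>h. \<Sum>n. power_deriv n q h * a n"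
  have D: "(f has_derivative ?D) (at q)"
    by (rule has_power_series_has_derivative[OF f q])
  then interpret D: bounded_linear ?D
    by (rule has_derivative_bounded_linear)
  have "((\<lambda>t. f (q + of_real t)) has_derivative (\<lambda>h. ?D (of_real h))) (at 0)"
    by (rule has_derivative_compose[of "\<lambda>t. q + of_real t" of_real, where g = f and g' = ?D])
      (auto intro!: derivative_eq_intros simp: D)
  then have "((\<lambda>t. f (q + of_real t)) has_vector_derivative ?D 1) (at 0)"
    by (simp add: has_vector_derivative_def of_real_def D.scaleR del: power_deriv.simps)
  then have "deriv_x0 f q = ?D 1"
    unfolding deriv_x0_def by (rule vector_derivative_at)
  then show "(\<lambda>n. q ^ n * shift_coeffs a n) sums deriv_x0 f q"
    using power_deriv_suminf_commute[OF f q, of 1] by simp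
qed

text \<open>A point of the slice of \<open>i\<close> commutes with \<open>i\<close>, so the
  differential in the direction \<open>i\<close> is \<open>i\<close> times the one in the direction
  1. With \<open>i * i = - 1\<close> this is the slice equation.\<close>

lemma has_power_series_slice_regular:
  assumes f: "has_power_series f a"
  shows "slice_regular f"
  unfolding slice_regular_def
proof (intro conjI ballI allI impI)
  show "f differentiable_on ball 0 1"
    unfolding differentiable_on_eq_differentiable_at[OF open_ball] differentiable_def
    using has_power_series_has_derivative(1)[OF f] by blast
  fix i x y
  assume i: "i \<in> imag_units" and xy: "slice_point i (x, y) \<in> slice_ball i"
  define q where "q = slice_embed i (Complex x y)"
  have q: "q \<in> ball 0 1"
    using xy by (simp add: slice_ball_def slice_point_eq_embed q_def)
  let ?D = "\<lambda>h. \<Sum>n. power_deriv n q h * a n"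
  have D: "(f has_derivative ?D) (at q)"
    by (rule has_power_series_has_derivative[OF f q])
  then interpret D: bounded_linear ?D
    by (rule has_derivative_bounded_linear)
  have D': "(f has_derivative ?D) (at (of_real x + i * of_real y))"
    using D by (simp add: q_def slice_embed_alt)
  have "((\<lambda>s. f (slice_point i (s, y))) has_derivative (\<lambda>h. ?D (of_real h))) (at x)"
    by (rule has_derivative_compose[of "\<lambda>s. slice_point i (s, y)" of_real, where g = f and g' = ?D])
      (auto simp: slice_point_def D' intro!: derivative_eq_intros)
  then have 1: "((\<lambda>s. f (slice_point i (s, y))) has_vector_derivative ?D 1) (at x)"
    by (simp add: has_vector_derivative_def of_real_def D.scaleR)
  have "((\<lambda>t. f (slice_point i (x, t))) has_derivative (\<lambda>h. ?D (i * of_real h))) (at y)"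
    by (rule has_derivative_compose[of "\<lambda>t. slice_point i (x, t)" "\<lambda>h. i * of_real h", where g = f and g' = ?D])
      (auto simp: slice_point_def D' intro!: derivative_eq_intros)
  then have 2: "((\<lambda>t. f (slice_point i (x, t))) has_vector_derivative ?D i) (at y)"
    by (simp add: has_vector_derivative_def of_real_def D.scaleR)
  have "q * i = i * q"
    using slice_embed_commute[OF i, of _ \<i>] by (simp add: q_def)
  then have "(\<lambda>n. i * (q ^ n * shift_coeffs a n)) sums ?D i"
    by (rule power_deriv_suminf_commute[OF f q])
  moreover have "(\<lambda>n. i * (q ^ n * shift_coeffs a n)) sums (i * ?D 1)"
    using power_deriv_suminf_commute[OF f q, of 1] by (intro sums_mult) simp
  ultimately have "?D i = i * ?D 1"
    by (rule sums_unique2)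
  then have "?D 1 + i * ?D i = 0"
    using imag_units_square[OF i] by (simp flip: mult.assoc)
  then show "vector_derivative (\<lambda>s. f (slice_point i (s, y))) (at x)
      + i * vector_derivative (\<lambda>t. f (slice_point i (x, t))) (at y) = 0"
    by (simp only: vector_derivative_at[OF 1] vector_derivative_at[OF 2])
qed

section \<open>Uniqueness of coefficients and linear operations on series\<close>

lemma has_power_series_unique:
  assumes "has_power_series f a" "has_power_series f b"
  shows "a = b"
  by (rule real_quat_powser_unique[where f = "\<lambda>t. f (of_real t)"])
    (use assms in \<open>auto simp: has_power_series_def\<close>)

lemma has_power_series_add:
  assumes "has_power_series f a" "has_power_series g b"
  shows "has_power_series (f + g) (\<lambda>n. a n + b n)"
  using assms by (auto simp: has_power_series_def distrib_left intro: sums_add)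

lemma has_power_series_diff:
  assumes "has_power_series f a" "has_power_series g b"
  shows "has_power_series (f - g) (\<lambda>n. a n - b n)"
  using assms by (auto simp: has_power_series_def right_diff_distrib intro: sums_diff)

lemma has_power_series_scale:
  assumes "has_power_series f a"
  shows "has_power_series (\<lambda>q. f q * c) (\<lambda>n. a n * c)"
  using assms by (auto simp: has_power_series_def simp flip: mult.assoc intro: sums_mult2)

lemma has_power_series_at_0:
  assumes "has_power_series f a"
  shows "f 0 = a 0"
proof (rule sums_unique2)
  show "(\<lambda>n. 0 ^ n * a n) sums f 0"
    using assms by (simp add: has_power_series_def)
  show "(\<lambda>n. 0 ^ n * a n) sums a 0"
    using sums_finite[of "{0}" "\<lambda>n. 0 ^ n * a n"] by simp
qed

section \<open>Parseval identity on a slice\<close>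

lemma borel_ball [measurable]: "ball (x :: 'a::metric_space) r \<in> sets borel"
  by simp

section \<open>Rotation invariance of plane Lebesgue measure\<close>

lemma nn_integral_lborel_translate:
  fixes h :: "real \<Rightarrow> ennreal"
  assumes [measurable]: "h \<in> borel_measurable borel"
  shows "(\<integral>\<^sup>+x. h (x + c) \<partial>lborel) = (\<integral>\<^sup>+x. h x \<partial>lborel)"
proof -
  have "(\<integral>\<^sup>+x. h x \<partial>lborel) = (\<integral>\<^sup>+x. h x \<partial>distr lborel borel ((+) c))"
    by (simp add: lborel_distr_plus)
  also have "\<dots> = (\<integral>\<^sup>+x. h (x + c) \<partial>lborel)"
    by (subst nn_integral_distr) (simp_all add: add.commute)
  finally show ?thesis ..
qed

text \<open>For a fixed second coordinate the shear is a translation of the line, so Tonelli's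
  theorem reduces the claim to translation invariance.\<close>

lemma nn_integral_shear_fst:
  fixes h :: "real \<times> real \<Rightarrow> ennreal"
  assumes [measurable]: "h \<in> borel_measurable borel"
  shows "(\<integral>\<^sup>+p. h (fst p + t * snd p, snd p) \<partial>lborel) = (\<integral>\<^sup>+p. h p \<partial>lborel)"
proof -
  have [measurable]: "h \<in> borel_measurable (lborel \<Otimes>\<^sub>M lborel)"
    by (simp add: lborel_prod)
  have "(\<integral>\<^sup>+p. h (fst p + t * snd p, snd p) \<partial>(lborel \<Otimes>\<^sub>M lborel))
      = (\<integral>\<^sup>+y. \<integral>\<^sup>+x. h (x + t * y, y) \<partial>lborel \<partial>lborel)"
    by (subst lborel_pair.nn_integral_snd[symmetric]) simp_all
  also have "\<dots> = (\<integral>\<^sup>+y. \<integral>\<^sup>+x. h (x, y) \<partial>lborel \<partial>lborel)"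
    by (intro nn_integral_cong nn_integral_lborel_translate[where h = "\<lambda>x. h (x, _)"]) simp
  also have "\<dots> = (\<integral>\<^sup>+p. h p \<partial>(lborel \<Otimes>\<^sub>M lborel))"
    by (rule lborel_pair.nn_integral_snd) simp
  finally show ?thesis
    by (simp add: lborel_prod)
qed

lemma nn_integral_shear_snd:
  fixes h :: "real \<times> real \<Rightarrow> ennreal"
  assumes [measurable]: "h \<in> borel_measurable borel"
  shows "(\<integral>\<^sup>+p. h (fst p, snd p + t * fst p) \<partial>lborel) = (\<integral>\<^sup>+p. h p \<partial>lborel)"
proof -
  have [measurable]: "h \<in> borel_measurable (lborel \<Otimes>\<^sub>M lborel)"
    by (simp add: lborel_prod)
  have "(\<integral>\<^sup>+p. h (fst p, snd p + t * fst p) \<partial>(lborel \<Otimes>\<^sub>M lborel))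
      = (\<integral>\<^sup>+x. \<integral>\<^sup>+y. h (x, y + t * x) \<partial>lborel \<partial>lborel)"
    by (subst lborel.nn_integral_fst[symmetric]) simp_all
  also have "\<dots> = (\<integral>\<^sup>+x. \<integral>\<^sup>+y. h (x, y) \<partial>lborel \<partial>lborel)"
    by (intro nn_integral_cong nn_integral_lborel_translate[where h = "\<lambda>y. h (_, y)"]) simp
  also have "\<dots> = (\<integral>\<^sup>+p. h p \<partial>(lborel \<Otimes>\<^sub>M lborel))"
    by (rule lborel.nn_integral_fst) simp
  finally show ?thesis
    by (simp add: lborel_prod)
qed

text \<open>Complex multiplication by \<open>w\<close> written on pairs, because
  \<open>slice_area\<close> is a pushforward from \<open>real \<times> real\<close>. It is a
  rotation when \<open>w\<close> has norm 1.\<close>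

definition rotate_plane :: "complex \<Rightarrow> real \<times> real \<Rightarrow> real \<times> real" where
  "rotate_plane w p = (Re w * fst p - Im w * snd p, Im w * fst p + Re w * snd p)"

lemma continuous_rotate_plane: "continuous_on S (rotate_plane w)"
  unfolding rotate_plane_def by (intro continuous_intros)

lemma measurable_rotate_plane [measurable]: "rotate_plane w \<in> borel_measurable borel"
  by (intro borel_measurable_continuous_onI continuous_rotate_plane)

lemma distr_lborel_rotate_plane:
  assumes w: "norm w = 1" "w \<noteq> - 1"
  shows "distr lborel borel (rotate_plane w) = lborel"
proof (rule measure_eqI)
  fix A
  assume "A \<in> sets (distr lborel borel (rotate_plane w))"
  then have A [measurable]: "A \<in> sets borel"
    by simp
  have sq: "(Re w)\<^sup>2 + (Im w)\<^sup>2 = 1"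
    using w(1) by (simp add: cmod_def)
  have "Re w \<noteq> - 1"
  proof
    assume "Re w = - 1"
    with sq w(2) show False
      by (simp add: complex_eq_iff)
  qed
  then have nz: "1 + Re w \<noteq> 0"
    by (simp add: add_eq_0_iff)
  \<comment> \<open>Minus the tangent of half the rotation angle; the half turn
    \<open>w = - 1\<close> is excluded because this is undefined there.\<close>
  define a where "a = - Im w / (1 + Re w)"
  have a: "a * (1 + Re w) = - Im w"
    using nz by (simp add: a_def)
  have "Im w * Im w = (1 - Re w) * (1 + Re w)"
    using sq by algebra
  then have "a * Im w = - (1 - Re w)"
    using nz by (simp add: a_def)
  with a have ab: "1 + a * Im w = Re w" "a * Re w + a = - Im w"
    by (simp_all add: algebra_simps)
  \<comment> \<open>A rotation by an angle other than \<open>\<pi>\<close> is a product of three shears.\<close>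
  define S :: "real \<times> real \<Rightarrow> real \<times> real" where "S p = (fst p + a * snd p, snd p)" for p
  define T :: "real \<times> real \<Rightarrow> real \<times> real" where "T p = (fst p, snd p + Im w * fst p)" for p
  have [measurable]: "S \<in> borel_measurable borel" "T \<in> borel_measurable borel"
    unfolding S_def[abs_def] T_def[abs_def]
    by (intro borel_measurable_continuous_onI continuous_intros)+
  have R: "rotate_plane w p = S (T (S p))" for p
  proof -
    have "Re w * fst p - Im w * snd p = fst p + a * snd p + a * (snd p + Im w * (fst p + a * snd p))"
    proof -
      have "fst p + a * snd p + a * (snd p + Im w * (fst p + a * snd p))
          = (1 + a * Im w) * fst p + (a * (1 + a * Im w) + a) * snd p"
        by (simp add: algebra_simps)
      then show ?thesis
        unfolding ab(1) by (simp add: ab(2))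
    qed
    moreover have "Im w * fst p + Re w * snd p = snd p + Im w * (fst p + a * snd p)"
      by (simp add: algebra_simps flip: ab(1))
    ultimately show ?thesis
      by (simp add: rotate_plane_def S_def T_def)
  qed
  have S_int: "(\<integral>\<^sup>+p. h (S p) \<partial>lborel) = (\<integral>\<^sup>+p. h p \<partial>lborel)"
    and T_int: "(\<integral>\<^sup>+p. h (T p) \<partial>lborel) = (\<integral>\<^sup>+p. h p \<partial>lborel)"
    if "h \<in> borel_measurable borel" for h :: "real \<times> real \<Rightarrow> ennreal"
    unfolding S_def T_def
    by (rule nn_integral_shear_fst[OF that], rule nn_integral_shear_snd[OF that])
  have "emeasure (distr lborel borel (rotate_plane w)) A
      = (\<integral>\<^sup>+p. indicator A p \<partial>distr lborel borel (rotate_plane w))"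
    by simp
  also have "\<dots> = (\<integral>\<^sup>+p. indicator A (rotate_plane w p) \<partial>lborel)"
    by (rule nn_integral_distr) auto
  also have "\<dots> = (\<integral>\<^sup>+p. indicator A (S (T (S p))) \<partial>lborel)"
    by (simp add: R)
  also have "\<dots> = (\<integral>\<^sup>+p. indicator A (S (T p)) \<partial>lborel)"
    by (rule S_int) measurable
  also have "\<dots> = (\<integral>\<^sup>+p. indicator A (S p) \<partial>lborel)"
    by (rule T_int) measurable
  also have "\<dots> = (\<integral>\<^sup>+p. indicator A p \<partial>lborel)"
    by (rule S_int) measurable
  finally show "emeasure (distr lborel borel (rotate_plane w)) A = emeasure lborel A"
    by simp
qed simp

section \<open>Orthogonality of monomials on a disc\<close>

lemma slice_point_rotate_plane:
  assumes "i \<in> imag_units"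
  shows "slice_point i (rotate_plane w p) = slice_embed i w * slice_point i p"
proof -
  have "slice_point i (rotate_plane w p) = slice_embed i (w * Complex (fst p) (snd p))"
    by (simp add: slice_embed_def rotate_plane_def add.commute)
  then show ?thesis
    by (simp add: slice_embed_mult[OF assms]) (simp add: slice_embed_def)
qed

lemma norm_slice_point:
  assumes "i \<in> imag_units"
  shows "norm (slice_point i p) = norm p"
  using norm_slice_embed[OF assms, of "Complex (fst p) (snd p)"]
  by (cases p) (simp add: slice_embed_def norm_Pair cmod_def)

lemma norm_rotate_plane:
  assumes "norm w = 1"
  shows "norm (rotate_plane w p) = norm p"
proof -
  have "norm (slice_point (Quat 0 1 0 0) (rotate_plane w p)) = norm (slice_point (Quat 0 1 0 0) p)"
    using assms
    by (simp add: slice_point_rotate_plane[OF imag_units_nonempty] norm_mult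
        norm_slice_embed[OF imag_units_nonempty])
  then show ?thesis
    by (simp add: norm_slice_point[OF imag_units_nonempty])
qed

lemma slice_point_alt: "slice_point i p = of_real (fst p) + i * of_real (snd p)"
  by (simp add: slice_point_def case_prod_unfold)

lemma continuous_on_slice_point [continuous_intros]: "continuous_on S (slice_point i)"
  unfolding slice_point_alt by (intro continuous_intros)

lemma measurable_slice_point [measurable]: "slice_point i \<in> borel_measurable borel"
  by (intro borel_measurable_continuous_onI continuous_intros)

text \<open>The real inner product suffices for squares of norms. The coefficients \<open>x\<close>
  and \<open>y\<close> stay inside the integral because they need not commute with the
  monomials.\<close>

definition monomial_pairing :: "quat \<Rightarrow> real \<Rightarrow> nat \<Rightarrow> nat \<Rightarrow> quat \<Rightarrow> quat \<Rightarrow> real" where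
  "monomial_pairing i r n m x y =
     (LINT p:ball 0 r|lborel. inner (slice_point i p ^ n * x) (slice_point i p ^ m * y))"

text \<open>Rotating the disc multiplies the two monomials by the n-th and m-th powers of a unit
  quaternion of the slice. The common m-th power acts isometrically and cancels; the remaining power
  commutes with the monomial and moves next to \<open>x\<close>.\<close>

lemma monomial_pairing_rotate:
  assumes i: "i \<in> imag_units" and w: "norm w = 1" "w \<noteq> - 1" and "m \<le> n"
  shows "monomial_pairing i r n m x y = monomial_pairing i r n m (slice_embed i w ^ (n - m) * x) y"
proof -
  let ?U = "slice_embed i w"
  have U: "norm (?U ^ m) = 1"
    using w by (simp add: norm_power norm_slice_embed[OF i])
  have comm: "?U * slice_point i p = slice_point i p * ?U" for p
    using slice_embed_commute[OF i, of w "Complex (fst p) (snd p)"] by (simp add: slice_embed_def)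
  have pow: "(?U * slice_point i p) ^ k = ?U ^ k * slice_point i p ^ k" for p k
  proof (induction k)
    case (Suc k)
    have "(?U * slice_point i p) ^ Suc k = ?U * (slice_point i p * ?U ^ k) * slice_point i p ^ k"
      by (simp add: Suc mult.assoc)
    also have "slice_point i p * ?U ^ k = ?U ^ k * slice_point i p"
      by (rule power_commuting_commutes[OF comm, symmetric])
    finally show ?case
      by (simp add: mult.assoc)
  qed simp
  have swap: "?U ^ k * slice_point i p ^ l = slice_point i p ^ l * ?U ^ k" for p k l
    by (rule power_commuting_commutes[OF power_commuting_commutes[OF comm, symmetric], symmetric])
  have eq: "inner ((?U * slice_point i p) ^ n * x) ((?U * slice_point i p) ^ m * y)
      = inner (slice_point i p ^ n * (?U ^ (n - m) * x)) (slice_point i p ^ m * y)" for p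
  proof -
    have "(?U * slice_point i p) ^ n * x = ?U ^ m * (?U ^ (n - m) * slice_point i p ^ n) * x"
      using \<open>m \<le> n\<close> by (simp add: pow mult.assoc flip: power_add mult.assoc)
    also have "\<dots> = ?U ^ m * (slice_point i p ^ n * (?U ^ (n - m) * x))"
      by (simp add: swap mult.assoc)
    finally show ?thesis
      by (simp add: pow mult.assoc inner_quat_mult_left_unit[OF U])
  qed
  have "monomial_pairing i r n m x y =
    (LINT p|distr lborel borel (rotate_plane w). indicator (ball 0 r) p *\<^sub>R
        inner (slice_point i p ^ n * x) (slice_point i p ^ m * y))"
    by (simp add: monomial_pairing_def set_lebesgue_integral_def distr_lborel_rotate_plane[OF w])
  also have "\<dots> = (LINT p|lborel. indicator (ball 0 r) (rotate_plane w p) *\<^sub>R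
        inner (slice_point i (rotate_plane w p) ^ n * x) (slice_point i (rotate_plane w p) ^ m * y))"
    by (rule integral_distr) measurable
  also have "\<dots> = monomial_pairing i r n m (?U ^ (n - m) * x) y"
    unfolding monomial_pairing_def set_lebesgue_integral_def slice_point_rotate_plane[OF i] eq
    by (intro Bochner_Integration.integral_cong)
      (simp_all add: norm_rotate_plane[OF w(1)] indicator_def)
  finally show ?thesis .
qed

lemma monomial_pairing_commute: "monomial_pairing i r n m x y = monomial_pairing i r m n y x"
  by (simp add: monomial_pairing_def inner_commute)

text \<open>A rotation by a suitable angle replaces \<open>x\<close> by \<open>i x\<close>, hence two of them give \<open>- x\<close>.\<close>

lemma monomial_pairing_orthogonal:
  assumes i: "i \<in> imag_units" and "n \<noteq> m"
  shows "monomial_pairing i r n m x y = 0"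
proof -
  have *: "monomial_pairing i r n m x y = 0" if "m < n" for n m x y
  proof -
    \<comment> \<open>A quarter turn divided by \<open>n - m\<close>, so that
      \<open>w ^ (n - m) = \<i>\<close>.\<close>
    define w where "w = cis (pi / 2 / real (n - m))"
    \<comment> \<open>Keeps \<open>w\<close> away from - 1, as the rotation lemma requires.\<close>
    have "Re w \<ge> 0"
      unfolding w_def cis.sel
    proof (rule cos_ge_zero)
      have "pi / 2 / real (n - m) \<le> pi / 2 / 1"
        using that by (intro divide_left_mono) auto
      then show "pi / 2 / real (n - m) \<le> pi / 2"
        by simp
      have "0 \<le> pi / 2 / real (n - m)"
        by simp
      then show "- (pi / 2) \<le> pi / 2 / real (n - m)"
        by (rule order_trans[rotated]) simp
    qed
    then have w: "norm w = 1" "w \<noteq> - 1"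
      by (simp add: w_def) (use \<open>Re w \<ge> 0\<close> in auto)
    have "k * (pi / 2 / k) = pi / 2" if "k \<noteq> 0" for k :: real
      using that by simp
    from this[of "real (n - m)"] have "real (n - m) * (pi / 2 / real (n - m)) = pi / 2"
      using that by (metis of_nat_0_eq_iff not_less_zero zero_less_diff)
    then have "w ^ (n - m) = \<i>"
      unfolding w_def Complex.DeMoivre by (simp only: cis_pi_half)
    then have U: "slice_embed i w ^ (n - m) = i"
      by (simp flip: slice_embed_power[OF i])
    have "monomial_pairing i r n m x y = monomial_pairing i r n m (i * (i * x)) y"
      using monomial_pairing_rotate[OF i w, of m n] that by (simp add: U)
    also have "i * (i * x) = - x"
      using imag_units_square[OF i] by (simp flip: mult.assoc)
    also have "monomial_pairing i r n m (- x) y = - monomial_pairing i r n m x y"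
      by (simp add: monomial_pairing_def set_lebesgue_integral_def)
    finally show ?thesis
      by simp
  qed
  show ?thesis
    using \<open>n \<noteq> m\<close> *[of m n x y] *[of n m y x] by (auto simp: monomial_pairing_commute[of i r n m] neq_iff)
qed

section \<open>Moments of the disc and Parseval's identity\<close>

text \<open>Equals \<open>pi * r ^ (2 * n + 2) / (n + 1)\<close> for r \<ge> 0. The radius is a
  parameter because the identity is first proved on smaller discs.\<close>

definition disc_moment :: "real \<Rightarrow> nat \<Rightarrow> real" where
  "disc_moment r n = (LINT p:ball (0 :: real \<times> real) r|lborel. norm p ^ (2 * n))"

lemma set_integrable_ball_continuous:
  fixes f :: "'a::euclidean_space \<Rightarrow> 'b::{banach, second_countable_topology}"
  assumes "continuous_on UNIV f"
  shows "set_integrable lborel (ball 0 r) f"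
proof (rule set_integrable_subset)
  show "set_integrable lborel (cball 0 r) f"
    unfolding set_integrable_def
    by (rule borel_integrable_compact) (use assms continuous_on_subset in auto)
qed auto

lemma norm_partial_sum_integral:
  assumes i: "i \<in> imag_units"
  shows "(LINT p:ball 0 r|lborel. (norm (\<Sum>n<N. slice_point i p ^ n * b n))\<^sup>2)
    = (\<Sum>n<N. (norm (b n))\<^sup>2 * disc_moment r n)"
proof -
  have int: "set_integrable lborel (ball 0 r)
      (\<lambda>p. inner (slice_point i p ^ n * b n) (slice_point i p ^ m * b m))" for n m
    by (intro set_integrable_ball_continuous continuous_intros)
  have "(LINT p:ball 0 r|lborel. (norm (\<Sum>n<N. slice_point i p ^ n * b n))\<^sup>2)
     = (LINT p:ball 0 r|lborel. \<Sum>n<N. \<Sum>m<N.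
          inner (slice_point i p ^ n * b n) (slice_point i p ^ m * b m))"
    by (simp add: power2_norm_eq_inner inner_sum_left inner_sum_right) (subst sum.swap, rule refl)
  also have "\<dots> = (\<Sum>n<N. \<Sum>m<N. monomial_pairing i r n m (b n) (b m))"
    unfolding monomial_pairing_def
    using int unfolding set_lebesgue_integral_def set_integrable_def scaleR_sum_right
    by - (subst Bochner_Integration.integral_sum, rule Bochner_Integration.integrable_sum, assumption,
        rule sum.cong[OF refl], rule Bochner_Integration.integral_sum, assumption)
  also have "\<dots> = (\<Sum>n<N. \<Sum>m<N. if n = m then monomial_pairing i r n n (b n) (b n) else 0)"
    by (intro sum.cong) (auto simp: monomial_pairing_orthogonal[OF i])
  also have "\<dots> = (\<Sum>n<N. monomial_pairing i r n n (b n) (b n))"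
    by simp
  also have "\<dots> = (\<Sum>n<N. (norm (b n))\<^sup>2 * disc_moment r n)"
    by (intro sum.cong) (simp_all add: monomial_pairing_def disc_moment_def norm_mult norm_power
        norm_slice_point[OF i] power_mult_distrib mult.commute[of _ "(norm (b _))\<^sup>2"]
        power_even_eq flip: power2_norm_eq_inner)
  finally show ?thesis .
qed

text \<open>A pointwise limit of polynomials on the ball. The indicator cuts \<open>g\<close> off
  because nothing is assumed about its values elsewhere.\<close>

lemma measurable_has_power_series:
  assumes "has_power_series g b"
  shows "(\<lambda>q. indicator (ball 0 1) q *\<^sub>R g q) \<in> borel_measurable borel"
proof (rule borel_measurable_LIMSEQ_metric)
  show "(\<lambda>q. indicator (ball 0 1) q *\<^sub>R (\<Sum>n<N. q ^ n * b n)) \<in> borel_measurable borel" for N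
    by (intro borel_measurable_scaleR borel_measurable_indicator borel_measurable_continuous_onI
        continuous_intros) auto
  fix q :: quat
  show "(\<lambda>N. indicator (ball 0 1) q *\<^sub>R (\<Sum>n<N. q ^ n * b n)) \<longlonglongrightarrow> indicator (ball 0 1) q *\<^sub>R g q"
    using assms by (cases "q \<in> ball 0 1") (auto simp: has_power_series_def sums_def)
qed

text \<open>For r < 1 all partial sums are bounded on the disc by the constant \<open>M\<close>, so
  dominated convergence carries the identity for polynomials to the limit. At radius 1 there need be
  no such constant.\<close>

lemma sums_norm_square_ball:
  assumes i: "i \<in> imag_units" and g: "has_power_series g b" and r: "0 \<le> r" "r < 1"
  shows "set_integrable lborel (ball 0 r) (\<lambda>p. (norm (g (slice_point i p)))\<^sup>2)"
    and "(\<lambda>n. (norm (b n))\<^sup>2 * disc_moment r n) sums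
      (LINT p:ball 0 r|lborel. (norm (g (slice_point i p)))\<^sup>2)"
proof -
  let ?s = "\<lambda>N p. \<Sum>n<N. slice_point i p ^ n * b n"
  let ?ind = "indicator (ball (0::real \<times> real) r) :: real \<times> real \<Rightarrow> real"
  define M where "M = (\<Sum>n. norm (b n) * r ^ n)"
  have summ: "summable (\<lambda>n. norm (b n) * r ^ n)"
    by (rule has_power_series_summable[OF g r])
  have bound: "norm (?s N p) \<le> M" if "p \<in> ball 0 r" for N p
  proof -
    have "norm (?s N p) \<le> (\<Sum>n<N. norm (b n) * r ^ n)"
      using that r by (intro sum_norm_le)
        (auto simp: norm_mult norm_power norm_slice_point[OF i] mult.commute[of "norm (b _)"]
          intro!: mult_right_mono power_mono)
    also have "\<dots> \<le> M"
      unfolding M_def by (rule sum_le_suminf[OF summ]) (use r in auto)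
    finally show ?thesis .
  qed
  have lim: "(\<lambda>N. ?ind p *\<^sub>R (norm (?s N p))\<^sup>2) \<longlonglongrightarrow> ?ind p *\<^sub>R (norm (g (slice_point i p)))\<^sup>2" for p
  proof (cases "p \<in> ball 0 r")
    case True
    then have "(\<lambda>N. ?s N p) \<longlonglongrightarrow> g (slice_point i p)"
      using g r by (auto simp: has_power_series_def sums_def norm_slice_point[OF i])
    then show ?thesis
      by (intro tendsto_intros)
  qed simp
  have meas: "(\<lambda>p. ?ind p *\<^sub>R (norm (?s N p))\<^sup>2) \<in> borel_measurable lborel" for N
    by measurable
  have meas': "(\<lambda>p. ?ind p *\<^sub>R (norm (g (slice_point i p)))\<^sup>2) \<in> borel_measurable lborel"
    by (rule borel_measurable_LIMSEQ_metric[OF meas lim])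
  have w: "integrable lborel (\<lambda>p. ?ind p *\<^sub>R M\<^sup>2)"
    using set_integrable_ball_continuous[of "\<lambda>p::real \<times> real. M\<^sup>2" r] by (simp add: set_integrable_def)
  have dom: "AE p in lborel. norm (?ind p *\<^sub>R (norm (?s N p))\<^sup>2) \<le> ?ind p *\<^sub>R M\<^sup>2" for N
    using bound by (auto simp: indicator_def intro!: AE_I2 power_mono)
  show "set_integrable lborel (ball 0 r) (\<lambda>p. (norm (g (slice_point i p)))\<^sup>2)"
    unfolding set_integrable_def
    by (rule integrable_dominated_convergence[OF meas' meas w AE_I2[OF lim] dom])
  have "(\<lambda>N. LINT p:ball 0 r|lborel. (norm (?s N p))\<^sup>2) \<longlonglongrightarrow>
      (LINT p:ball 0 r|lborel. (norm (g (slice_point i p)))\<^sup>2)"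
    unfolding set_lebesgue_integral_def
    by (rule integral_dominated_convergence[OF meas' meas w AE_I2[OF lim] dom])
  then show "(\<lambda>n. (norm (b n))\<^sup>2 * disc_moment r n) sums
      (LINT p:ball 0 r|lborel. (norm (g (slice_point i p)))\<^sup>2)"
    by (simp add: norm_partial_sum_integral[OF i] sums_def)
qed

lemma disc_moment_nonneg: "0 \<le> disc_moment r n"
  unfolding disc_moment_def set_lebesgue_integral_def by (intro Bochner_Integration.integral_nonneg) auto

lemma nn_integral_disc_moment:
  "(\<integral>\<^sup>+p\<in>ball (0 :: real \<times> real) r. ennreal (c * norm p ^ (2 * n)) \<partial>lborel) = ennreal (c * disc_moment r n)"
  if "0 \<le> c"
proof -
  have int: "integrable lborel (\<lambda>p :: real \<times> real. indicator (ball 0 r) p *\<^sub>R (c * norm p ^ (2 * n)))"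
    using set_integrable_ball_continuous[of "\<lambda>p::real \<times> real. c * norm p ^ (2 * n)" r]
    by (simp add: set_integrable_def continuous_intros)
  have "(\<integral>\<^sup>+p\<in>ball (0 :: real \<times> real) r. ennreal (c * norm p ^ (2 * n)) \<partial>lborel)
     = (\<integral>\<^sup>+p. ennreal (indicator (ball 0 r) p *\<^sub>R (c * norm (p :: real \<times> real) ^ (2 * n))) \<partial>lborel)"
    by (intro nn_integral_cong) (auto simp: indicator_def)
  also have "\<dots> = ennreal (LINT p:ball (0 :: real \<times> real) r|lborel. c * norm p ^ (2 * n))"
    unfolding set_lebesgue_integral_def
    by (rule nn_integral_eq_integral[OF int]) (use that in auto)
  finally show ?thesis
    by (simp add: disc_moment_def)
qed

text \<open>The sum is put back under the integral so that both sides integrate functions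
  independent of r over the same disc, the form in which the passage to radius 1 can be
  made.\<close>

lemma nn_integral_norm_square_ball:
  assumes i: "i \<in> imag_units" and g: "has_power_series g b" and r: "0 \<le> r" "r < 1"
  shows "(\<integral>\<^sup>+p\<in>ball 0 r. ennreal ((norm (g (slice_point i p)))\<^sup>2) \<partial>lborel)
    = (\<integral>\<^sup>+p\<in>ball (0 :: real \<times> real) r. (\<Sum>n. ennreal ((norm (b n))\<^sup>2 * norm p ^ (2 * n))) \<partial>lborel)"
proof -
  have "(\<integral>\<^sup>+p\<in>ball 0 r. ennreal ((norm (g (slice_point i p)))\<^sup>2) \<partial>lborel)
    = (\<integral>\<^sup>+p. ennreal (indicator (ball 0 r) p *\<^sub>R (norm (g (slice_point i p)))\<^sup>2) \<partial>lborel)"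
    by (intro nn_integral_cong) (auto simp: indicator_def)
  also have "\<dots> = ennreal (LINT p:ball 0 r|lborel. (norm (g (slice_point i p)))\<^sup>2)"
    unfolding set_lebesgue_integral_def
    by (rule nn_integral_eq_integral)
      (use sums_norm_square_ball(1)[OF assms] in \<open>auto simp: set_integrable_def\<close>)
  also have "\<dots> = (\<Sum>n. ennreal ((norm (b n))\<^sup>2 * disc_moment r n))"
    using sums_norm_square_ball(2)[OF assms]
    by (subst suminf_ennreal_eq) (auto simp: disc_moment_nonneg)
  also have "\<dots> = (\<Sum>n. \<integral>\<^sup>+p\<in>ball (0 :: real \<times> real) r. ennreal ((norm (b n))\<^sup>2 * norm p ^ (2 * n)) \<partial>lborel)"
    by (simp add: nn_integral_disc_moment)
  also have "\<dots> = (\<integral>\<^sup>+p. (\<Sum>n. ennreal ((norm (b n))\<^sup>2 * norm p ^ (2 * n)) * indicator (ball (0 :: real \<times> real) r) p) \<partial>lborel)"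
    by (rule nn_integral_suminf[symmetric]) measurable
  finally show ?thesis
    by simp
qed

text \<open>The discs of radius \<open>1 - 1 / (k + 1)\<close> increase to the unit disc; continuity
  from below of the measures with densities \<open>F\<close> and \<open>G\<close> gives the
  limit.\<close>

lemma set_nn_integral_unit_disc_eqI:
  fixes F G :: "real \<times> real \<Rightarrow> ennreal"
  assumes [measurable]: "F \<in> borel_measurable borel" "G \<in> borel_measurable borel"
    and eq: "\<And>r. \<lbrakk>0 \<le> r; r < 1\<rbrakk> \<Longrightarrow> (\<integral>\<^sup>+p\<in>ball 0 r. F p \<partial>lborel) = (\<integral>\<^sup>+p\<in>ball 0 r. G p \<partial>lborel)"
  shows "(\<integral>\<^sup>+p\<in>ball 0 1. F p \<partial>lborel) = (\<integral>\<^sup>+p\<in>ball 0 1. G p \<partial>lborel)"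
proof -
  define A :: "nat \<Rightarrow> (real \<times> real) set" where "A k = ball 0 (1 - 1 / (real k + 1))" for k
  have inc: "incseq A"
    unfolding A_def by (intro incseq_SucI subset_ball) (auto simp: frac_le)
  have Un: "(\<Union>k. A k) = ball 0 1"
  proof
    show "(\<Union>k. A k) \<subseteq> ball 0 1"
      by (intro UN_least) (simp add: A_def subset_ball)
    show "ball 0 1 \<subseteq> (\<Union>k. A k)"
    proof
      fix p :: "real \<times> real"
      assume "p \<in> ball 0 1"
      then obtain k where "1 / (real k + 1) < 1 - norm p"
        using nat_approx_posE[of "1 - norm p"] by (auto simp: add.commute)
      then show "p \<in> (\<Union>k. A k)"
        by (auto simp: A_def intro!: exI[of _ k])
    qed
  qed
  have disc: "(\<integral>\<^sup>+p\<in>ball 0 1. H p \<partial>lborel) = (SUP k. \<integral>\<^sup>+p\<in>A k. H p \<partial>lborel)"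
    if [measurable]: "H \<in> borel_measurable borel" for H :: "real \<times> real \<Rightarrow> ennreal"
  proof -
    have [measurable]: "A k \<in> sets borel" for k
      by (simp add: A_def)
    have "(SUP k. emeasure (density lborel H) (A k)) = emeasure (density lborel H) (\<Union>k. A k)"
      by (rule SUP_emeasure_incseq[OF _ inc]) auto
    then show ?thesis
      by (simp add: Un emeasure_density)
  qed
  have "(\<integral>\<^sup>+p\<in>A k. F p \<partial>lborel) = (\<integral>\<^sup>+p\<in>A k. G p \<partial>lborel)" for k
    unfolding A_def by (rule eq) auto
  then show ?thesis
    by (simp add: disc)
qed

text \<open>A linear image is a subspace, and subspaces of a finite-dimensional space are
  closed.\<close>

lemma borel_slice_plane: "slice_plane i \<in> sets borel"
proof -
  have "linear (slice_point i)"
    by (rule linearI) (simp_all add: slice_point_alt of_real_def algebra_simps)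
  then have "subspace (slice_plane i)"
    unfolding slice_plane_def by (intro linear_subspace_image) auto
  then show ?thesis
    by (simp add: closed_subspace)
qed

lemma borel_slice_ball [measurable]: "slice_ball i \<in> sets borel"
  unfolding slice_ball_def using borel_slice_plane by auto

lemma slice_point_in_slice_ball:
  assumes "i \<in> imag_units"
  shows "slice_point i p \<in> slice_ball i \<longleftrightarrow> p \<in> ball 0 1"
  by (simp add: slice_ball_def slice_plane_def norm_slice_point[OF assms])

text \<open>Stated in extended nonnegative reals, so it also covers infinite energy, and finiteness
  of the integral becomes summability of the series. The unit \<open>i\<close> does not occur on the
  right, which is the independence of the slice.\<close>

theorem slice_parseval:
  assumes i: "i \<in> imag_units" and g: "has_power_series g b"
  shows "(\<integral>\<^sup>+z\<in>slice_ball i. ennreal ((norm (g z))\<^sup>2) \<partial>slice_area i)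
    = (\<Sum>n. ennreal ((norm (b n))\<^sup>2 * disc_moment 1 n))"
proof -
  let ?h = "\<lambda>q. indicator (ball 0 1) q *\<^sub>R g q"
  have [measurable]: "?h \<in> borel_measurable borel"
    by (rule measurable_has_power_series[OF g])
  have "(\<integral>\<^sup>+z\<in>slice_ball i. ennreal ((norm (g z))\<^sup>2) \<partial>slice_area i)
      = (\<integral>\<^sup>+z\<in>slice_ball i. ennreal ((norm (?h z))\<^sup>2) \<partial>slice_area i)"
    by (intro nn_integral_cong) (auto simp: indicator_def slice_ball_def)
  also have "\<dots> = (\<integral>\<^sup>+p. ennreal ((norm (?h (slice_point i p)))\<^sup>2) * indicator (slice_ball i) (slice_point i p) \<partial>lborel)"
    unfolding slice_area_def by (rule nn_integral_distr) measurable
  also have "\<dots> = (\<integral>\<^sup>+p\<in>ball 0 1. ennreal ((norm (?h (slice_point i p)))\<^sup>2) \<partial>lborel)"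
    by (intro nn_integral_cong) (auto simp: indicator_def slice_point_in_slice_ball[OF i])
  also have "\<dots> = (\<integral>\<^sup>+p\<in>ball (0 :: real \<times> real) 1. (\<Sum>n. ennreal ((norm (b n))\<^sup>2 * norm p ^ (2 * n))) \<partial>lborel)"
  proof (rule set_nn_integral_unit_disc_eqI[of "\<lambda>p. ennreal ((norm (?h (slice_point i p)))\<^sup>2)"
        "\<lambda>p. \<Sum>n. ennreal ((norm (b n))\<^sup>2 * norm p ^ (2 * n))"])
    fix r :: real
    assume r: "0 \<le> r" "r < 1"
    have "(\<integral>\<^sup>+p\<in>ball 0 r. ennreal ((norm (?h (slice_point i p)))\<^sup>2) \<partial>lborel)
        = (\<integral>\<^sup>+p\<in>ball 0 r. ennreal ((norm (g (slice_point i p)))\<^sup>2) \<partial>lborel)"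
      using r by (intro nn_integral_cong) (auto simp: indicator_def norm_slice_point[OF i])
    then show "(\<integral>\<^sup>+p\<in>ball 0 r. ennreal ((norm (?h (slice_point i p)))\<^sup>2) \<partial>lborel)
        = (\<integral>\<^sup>+p\<in>ball (0 :: real \<times> real) r. (\<Sum>n. ennreal ((norm (b n))\<^sup>2 * norm p ^ (2 * n))) \<partial>lborel)"
      by (simp only: nn_integral_norm_square_ball[OF i g r])
  qed measurable
  also have "\<dots> = (\<integral>\<^sup>+p. (\<Sum>n. ennreal ((norm (b n))\<^sup>2 * norm p ^ (2 * n)) * indicator (ball (0 :: real \<times> real) 1) p) \<partial>lborel)"
    by simp
  also have "\<dots> = (\<Sum>n. \<integral>\<^sup>+p\<in>ball (0 :: real \<times> real) 1. ennreal ((norm (b n))\<^sup>2 * norm p ^ (2 * n)) \<partial>lborel)"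
    by (rule nn_integral_suminf) measurable
  finally show ?thesis
    by (simp add: nn_integral_disc_moment)
qed

text \<open>A small disc centred at \<open>(s, 0)\<close> fits between the circles of radius r and
  1, and the integrand is at least \<open>r ^ (2 * n)\<close> on it. Its area serves as
  \<open>c\<close> for all n at once.\<close>

lemma disc_moment_lower_bound:
  assumes r: "0 \<le> r" "r < 1"
  obtains c where "c > 0" "\<And>n. c * r ^ (2 * n) \<le> disc_moment 1 n"
proof -
  define s where "s = (r + 1) / 2"
  have s: "r < s" "s < 1"
    using r by (simp_all add: s_def)
  define B :: "(real \<times> real) set" where "B = ball (s, 0) (min (s - r) (1 - s))"
  have pos: "min (s - r) (1 - s) > 0"
    using s by simp
  have B: "B \<subseteq> ball 0 1" "\<And>p. p \<in> B \<Longrightarrow> r \<le> norm p"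
  proof -
    have "norm p < 1 \<and> r \<le> norm p" if "p \<in> B" for p
    proof -
      have n: "norm (s, 0::real) = s"
        using s r by (simp add: norm_Pair)
      have "dist (s, 0) p < s - r" "dist (s, 0) p < 1 - s"
        using that by (simp_all add: B_def)
      moreover have "norm (s, 0::real) - norm p \<le> dist (s, 0) p"
        unfolding dist_norm by (rule norm_triangle_ineq2)
      moreover have "norm p - norm (s, 0::real) \<le> dist (s, 0) p"
        unfolding dist_norm by (metis norm_minus_commute norm_triangle_ineq2)
      ultimately show ?thesis
        using n by linarith
    qed
    then show "B \<subseteq> ball 0 1" "\<And>p. p \<in> B \<Longrightarrow> r \<le> norm p"
      by auto
  qed
  have fin: "emeasure lborel B < \<infinity>"
    unfolding B_def by (intro emeasure_bounded_finite) simp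
  show ?thesis
  proof (rule that[of "measure lborel B"])
    show "measure lborel B > 0"
      unfolding B_def using content_ball_pos[OF pos] by simp
    fix n
    have "measure lborel B * r ^ (2 * n) = (LINT p:B|lborel. r ^ (2 * n))"
      by (simp add: set_lebesgue_integral_def B_def)
    also have "\<dots> \<le> disc_moment 1 n"
      unfolding disc_moment_def set_lebesgue_integral_def
    proof (rule integral_mono)
      show "integrable lborel (\<lambda>p. indicator B p *\<^sub>R r ^ (2 * n))"
        using fin by (simp add: B_def)
      show "integrable lborel (\<lambda>p :: real \<times> real. indicator (ball 0 1) p *\<^sub>R norm p ^ (2 * n))"
        using set_integrable_ball_continuous[of "\<lambda>p::real \<times> real. norm p ^ (2 * n)" 1]
        by (simp add: set_integrable_def continuous_intros)
      show "indicator B p *\<^sub>R r ^ (2 * n) \<le> indicator (ball 0 1) p *\<^sub>R norm p ^ (2 * n)" for p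
        using B(1) B(2)[of p] r by (cases "p \<in> B") (auto intro!: power_mono)
    qed
    finally show "measure lborel B * r ^ (2 * n) \<le> disc_moment 1 n" .
  qed
qed

lemma disc_moment_pos: "disc_moment 1 n > 0"
proof -
  obtain c where "c > 0" "c * (1 / 2) ^ (2 * n) \<le> disc_moment 1 n"
    using disc_moment_lower_bound[of "1 / 2"] by auto
  moreover from \<open>c > 0\<close> have "c * (1 / 2) ^ (2 * n) > 0"
    by simp
  ultimately show ?thesis
    by linarith
qed

section \<open>The Dirichlet space\<close>

text \<open>The weight 1 at index 0 accounts for the term from \<open>f 0\<close>. For n \<ge> 1 the
  weight is \<open>pi * n\<close>: the square of n from differentiation times the moment of index n
  - 1.\<close>

definition coeff_weight :: "nat \<Rightarrow> real" where
  "coeff_weight n = (case n of 0 \<Rightarrow> 1 | Suc m \<Rightarrow> (real (Suc m))\<^sup>2 * disc_moment 1 m)"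

definition weighted_square :: "(nat \<Rightarrow> quat) \<Rightarrow> nat \<Rightarrow> real" where
  "weighted_square a n = coeff_weight n * (norm (a n))\<^sup>2"

lemma coeff_weight_pos: "coeff_weight n > 0"
  by (auto simp: coeff_weight_def disc_moment_pos split: nat.split)

lemma weighted_square_nonneg: "weighted_square a n \<ge> 0"
  by (simp add: weighted_square_def coeff_weight_pos less_imp_le)

lemma weighted_square_0: "weighted_square a 0 = (norm (a 0))\<^sup>2"
  by (simp add: weighted_square_def coeff_weight_def)

lemma weighted_square_Suc:
  "weighted_square a (Suc n) = (norm (shift_coeffs a n))\<^sup>2 * disc_moment 1 n"
proof -
  have "norm (of_nat (Suc n) :: quat) = real (Suc n)"
    by (rule norm_of_nat)
  then show ?thesis
    by (simp add: weighted_square_def coeff_weight_def shift_coeffs_def norm_mult power_mult_distrib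
        del: of_nat_Suc)
qed

lemma weighted_square_eq_0_iff: "weighted_square a n = 0 \<longleftrightarrow> a n = 0"
  using coeff_weight_pos[of n] by (auto simp: weighted_square_def)

text \<open>The factor 2 comes from 2 x y \<le> x^2 + y^2. This termwise bound gives closure under
  addition by comparison of series.\<close>

lemma weighted_square_add_le:
  "weighted_square (\<lambda>n. a n + b n) n \<le> 2 * (weighted_square a n + weighted_square b n)"
proof -
  have "(norm (a n + b n))\<^sup>2 \<le> (norm (a n) + norm (b n))\<^sup>2"
    by (intro power_mono norm_triangle_ineq) simp
  also have "\<dots> \<le> 2 * ((norm (a n))\<^sup>2 + (norm (b n))\<^sup>2)"
    using sum_squares_bound[of "norm (a n)" "norm (b n)"] by (simp add: power2_sum)
  finally have "coeff_weight n * (norm (a n + b n))\<^sup>2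
      \<le> coeff_weight n * (2 * ((norm (a n))\<^sup>2 + (norm (b n))\<^sup>2))"
    by (intro mult_left_mono less_imp_le[OF coeff_weight_pos])
  then show ?thesis
    by (simp add: weighted_square_def algebra_simps)
qed

lemma weighted_square_scale: "weighted_square (\<lambda>n. a n * c) n = weighted_square a n * (norm c)\<^sup>2"
  by (simp add: weighted_square_def norm_mult power_mult_distrib)

lemma suminf_ennreal_finite_iff:
  assumes "\<And>n. 0 \<le> f n"
  shows "(\<Sum>n. ennreal (f n)) < \<infinity> \<longleftrightarrow> summable f"
proof
  assume "(\<Sum>n. ennreal (f n)) < \<infinity>"
  then show "summable f"
    by (intro summable_suminf_not_top assms) simp
next
  assume "summable f"
  then show "(\<Sum>n. ennreal (f n)) < \<infinity>"
    by (simp add: suminf_ennreal2[OF assms])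
qed

section \<open>Membership in terms of coefficients, and the linear structure\<close>

lemma slice_deriv_energy:
  assumes i: "i \<in> imag_units" and f: "has_power_series f a"
  shows "(\<integral>\<^sup>+z\<in>slice_ball i. ennreal ((norm (deriv_x0 f z))\<^sup>2) \<partial>slice_area i)
    = (\<Sum>n. ennreal (weighted_square a (Suc n)))"
  unfolding weighted_square_Suc
  by (rule slice_parseval[OF i has_power_series_deriv_x0[OF f]])

text \<open>By Parseval's identity the supremum runs over a constant family, nonempty since
  imaginary units exist. The term of index 0 is absent from the energy but does not affect
  summability.\<close>

lemma dirichlet_space_iff:
  "f \<in> dirichlet_space \<longleftrightarrow>
    (\<exists>a. has_power_series f a \<and> summable (weighted_square a)) \<and> (\<forall>q. q \<notin> ball 0 1 \<longrightarrow> f q = 0)"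
proof -
  have *: "(SUP i\<in>imag_units. \<integral>\<^sup>+z\<in>slice_ball i. ennreal ((norm (deriv_x0 f z))\<^sup>2) \<partial>slice_area i) < \<infinity>
      \<longleftrightarrow> summable (weighted_square a)" if f: "has_power_series f a" for a
  proof -
    have "(SUP i\<in>imag_units. \<integral>\<^sup>+z\<in>slice_ball i. ennreal ((norm (deriv_x0 f z))\<^sup>2) \<partial>slice_area i)
        = (SUP i\<in>imag_units. (\<Sum>n. ennreal (weighted_square a (Suc n))))"
      by (intro SUP_cong refl slice_deriv_energy[OF _ f])
    also have "\<dots> = (\<Sum>n. ennreal (weighted_square a (Suc n)))"
      using imag_units_nonempty by (intro cSUP_const) auto
    also have "\<dots> < \<infinity> \<longleftrightarrow> summable (\<lambda>n. weighted_square a (Suc n))"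
      by (intro suminf_ennreal_finite_iff weighted_square_nonneg)
    finally show ?thesis
      by (simp add: summable_Suc_iff)
  qed
  show ?thesis
  proof
    assume f: "f \<in> dirichlet_space"
    then obtain a where a: "has_power_series f a"
      using slice_regular_has_power_series unfolding dirichlet_space_def by blast
    with f *[OF a] show "(\<exists>a. has_power_series f a \<and> summable (weighted_square a)) \<and> (\<forall>q. q \<notin> ball 0 1 \<longrightarrow> f q = 0)"
      unfolding dirichlet_space_def by blast
  next
    assume "(\<exists>a. has_power_series f a \<and> summable (weighted_square a)) \<and> (\<forall>q. q \<notin> ball 0 1 \<longrightarrow> f q = 0)"
    then show "f \<in> dirichlet_space"
      using * has_power_series_slice_regular unfolding dirichlet_space_def by blast
  qed
qed

lemma dirichlet_spaceE:
  assumes "f \<in> dirichlet_space"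
  obtains a where "has_power_series f a" "summable (weighted_square a)"
  using assms dirichlet_space_iff by blast

lemma dirichlet_space_outside: "f \<in> dirichlet_space \<Longrightarrow> q \<notin> ball 0 1 \<Longrightarrow> f q = 0"
  by (simp add: dirichlet_space_def)

lemma dirichlet_space_zero: "0 \<in> dirichlet_space"
proof -
  have "has_power_series 0 (\<lambda>n. 0)"
    by (simp add: has_power_series_def)
  moreover have "summable (weighted_square (\<lambda>n. 0))"
    by (simp add: weighted_square_def[abs_def])
  ultimately show ?thesis
    by (auto simp: dirichlet_space_iff)
qed

lemma dirichlet_space_add:
  assumes f: "f \<in> dirichlet_space" and g: "g \<in> dirichlet_space"
  shows "f + g \<in> dirichlet_space"
proof -
  obtain a where a: "has_power_series f a" "summable (weighted_square a)"
    using f by (rule dirichlet_spaceE)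
  obtain b where b: "has_power_series g b" "summable (weighted_square b)"
    using g by (rule dirichlet_spaceE)
  have "summable (weighted_square (\<lambda>n. a n + b n))"
    by (rule summable_comparison_test'[OF summable_mult[OF summable_add[OF a(2) b(2)], of 2]])
      (use weighted_square_add_le weighted_square_nonneg in auto)
  then show ?thesis
    using has_power_series_add[OF a(1) b(1)] f g by (auto simp: dirichlet_space_iff)
qed

lemma dirichlet_space_scale:
  assumes f: "f \<in> dirichlet_space"
  shows "(\<lambda>q. f q * c) \<in> dirichlet_space"
proof -
  obtain a where a: "has_power_series f a" "summable (weighted_square a)"
    using f by (rule dirichlet_spaceE)
  have "summable (weighted_square (\<lambda>n. a n * c))"
    unfolding weighted_square_scale[abs_def] by (rule summable_mult2[OF a(2)])
  then show ?thesis
    using has_power_series_scale[OF a(1)] f by (auto simp: dirichlet_space_iff)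
qed

lemma dirichlet_space_diff:
  assumes "f \<in> dirichlet_space" "g \<in> dirichlet_space"
  shows "f - g \<in> dirichlet_space"
proof -
  have "f - g = f + (\<lambda>q. g q * (- 1))"
    by (simp add: fun_eq_iff)
  also have "\<dots> \<in> dirichlet_space"
    by (intro dirichlet_space_add dirichlet_space_scale assms)
  finally show ?thesis .
qed

section \<open>The pairing on one slice and its independence of the slice\<close>

text \<open>The integral part of \<open>dirichlet_inner\<close> for one unit, available before the
  description operator is known to have a value.\<close>

definition slice_pairing :: "quat \<Rightarrow> (quat \<Rightarrow> quat) \<Rightarrow> (quat \<Rightarrow> quat) \<Rightarrow> quat" where
  "slice_pairing i f g = (LINT z:slice_ball i|slice_area i. qcnj (deriv_x0 f z) * deriv_x0 g z)"

lemma bounded_linear_qcnj: "bounded_linear qcnj"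
  by (rule linear_conv_bounded_linear[THEN iffD1], rule linearI) (simp_all add: quat_eq_iff)

lemma qcnj_0 [simp]: "qcnj 0 = 0"
  by (simp add: quat_eq_iff)

lemma qcnj_mult: "qcnj (x * y) = qcnj y * qcnj x"
  by (simp add: quat_eq_iff algebra_simps)

lemma qcnj_qcnj [simp]: "qcnj (qcnj x) = x"
  by (simp add: quat_eq_iff)

lemma norm_qcnj [simp]: "norm (qcnj x) = norm x"
  by (simp add: norm_quat_def inner_quat_def)

lemma sets_slice_area [simp]: "sets (slice_area i) = sets borel"
  by (simp add: slice_area_def)

lemma measurable_slice_area [simp]: "borel_measurable (slice_area i) = borel_measurable borel"
  by (rule measurable_cong_sets) simp_all

lemma measurable_deriv_slice_ball:
  assumes f: "f \<in> dirichlet_space"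
  shows "(\<lambda>z. indicator (slice_ball i) z *\<^sub>R deriv_x0 f z) \<in> borel_measurable borel"
proof -
  obtain a where a: "has_power_series f a"
    using f by (rule dirichlet_spaceE)
  have [measurable]: "(\<lambda>q. indicator (ball 0 1) q *\<^sub>R deriv_x0 f q) \<in> borel_measurable borel"
    by (rule measurable_has_power_series[OF has_power_series_deriv_x0[OF a]])
  have "(\<lambda>q. indicator (slice_ball i) q *\<^sub>R (indicator (ball 0 1) q *\<^sub>R deriv_x0 f q) :: quat)
      \<in> borel_measurable borel"
    by measurable
  moreover have "indicator (slice_ball i) q *\<^sub>R (indicator (ball 0 1) q *\<^sub>R deriv_x0 f q)
      = indicator (slice_ball i) q *\<^sub>R deriv_x0 f q" for q
    by (auto simp: slice_ball_def indicator_def)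
  ultimately show ?thesis
    by (simp only:)
qed

lemma slice_norm_square_integral:
  assumes i: "i \<in> imag_units" and f: "has_power_series f a" and a: "summable (weighted_square a)"
  shows "set_integrable (slice_area i) (slice_ball i) (\<lambda>z. (norm (deriv_x0 f z))\<^sup>2)"
    and "(LINT z:slice_ball i|slice_area i. (norm (deriv_x0 f z))\<^sup>2) = (\<Sum>n. weighted_square a (Suc n))"
proof -
  let ?F = "\<lambda>z. indicator (slice_ball i) z *\<^sub>R (norm (deriv_x0 f z))\<^sup>2"
  have [measurable]: "(\<lambda>q. indicator (ball 0 1) q *\<^sub>R deriv_x0 f q) \<in> borel_measurable borel"
    by (rule measurable_has_power_series[OF has_power_series_deriv_x0[OF f]])
  have "?F = (\<lambda>z. indicator (slice_ball i) z *\<^sub>R (norm (indicator (ball 0 1) z *\<^sub>R deriv_x0 f z))\<^sup>2)"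
    by (auto simp: fun_eq_iff indicator_def slice_ball_def)
  also have "\<dots> \<in> borel_measurable borel"
    by measurable
  finally have meas: "?F \<in> borel_measurable (slice_area i)"
    by simp
  have summ: "summable (\<lambda>n. weighted_square a (Suc n))"
    using a by (simp add: summable_Suc_iff)
  have nonneg: "0 \<le> (\<Sum>n. weighted_square a (Suc n))"
    by (intro suminf_nonneg summ weighted_square_nonneg)
  have "(\<integral>\<^sup>+z. ennreal (?F z) \<partial>slice_area i)
      = (\<integral>\<^sup>+z\<in>slice_ball i. ennreal ((norm (deriv_x0 f z))\<^sup>2) \<partial>slice_area i)"
    by (intro nn_integral_cong) (auto simp: indicator_def)
  also have "\<dots> = (\<Sum>n. ennreal (weighted_square a (Suc n)))"
    by (rule slice_deriv_energy[OF i f])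
  also have "\<dots> = ennreal (\<Sum>n. weighted_square a (Suc n))"
    by (rule suminf_ennreal2[OF weighted_square_nonneg summ])
  finally have nn: "(\<integral>\<^sup>+z. ennreal (?F z) \<partial>slice_area i) = ennreal (\<Sum>n. weighted_square a (Suc n))" .
  have "integrable (slice_area i) ?F \<and> integral\<^sup>L (slice_area i) ?F = (\<Sum>n. weighted_square a (Suc n))"
    using nn_integral_eq_integrable[OF meas _ nonneg] nn by auto
  then show "set_integrable (slice_area i) (slice_ball i) (\<lambda>z. (norm (deriv_x0 f z))\<^sup>2)"
    and "(LINT z:slice_ball i|slice_area i. (norm (deriv_x0 f z))\<^sup>2) = (\<Sum>n. weighted_square a (Suc n))"
    by (simp_all add: set_integrable_def set_lebesgue_integral_def)
qed

text \<open>The integrand is dominated by the sum of the two squared norms, each integrable over the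
  slice.\<close>

lemma slice_pairing_integrable:
  assumes i: "i \<in> imag_units" and f: "f \<in> dirichlet_space" and g: "g \<in> dirichlet_space"
  shows "set_integrable (slice_area i) (slice_ball i) (\<lambda>z. qcnj (deriv_x0 f z) * deriv_x0 g z)"
proof -
  have sq: "set_integrable (slice_area i) (slice_ball i) (\<lambda>z. (norm (deriv_x0 h z))\<^sup>2)"
    if "h \<in> dirichlet_space" for h
    using that by (rule dirichlet_spaceE) (rule slice_norm_square_integral(1)[OF i])
  have meas: "(\<lambda>z. indicator (slice_ball i) z *\<^sub>R (qcnj (deriv_x0 f z) * deriv_x0 g z)) \<in> borel_measurable borel"
  proof -
    note [measurable] = measurable_deriv_slice_ball[OF f, of i] measurable_deriv_slice_ball[OF g, of i]
    have [measurable]: "qcnj \<in> borel_measurable borel"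
      using bounded_linear_qcnj
      by (intro borel_measurable_continuous_onI linear_continuous_on)
    have "(\<lambda>z. qcnj (indicator (slice_ball i) z *\<^sub>R deriv_x0 f z) * (indicator (slice_ball i) z *\<^sub>R deriv_x0 g z))
        \<in> borel_measurable borel"
      by measurable
    moreover have "qcnj (indicator (slice_ball i) z *\<^sub>R deriv_x0 f z) * (indicator (slice_ball i) z *\<^sub>R deriv_x0 g z)
        = indicator (slice_ball i) z *\<^sub>R (qcnj (deriv_x0 f z) * deriv_x0 g z)" for z
      by (auto simp: indicator_def)
    ultimately show ?thesis
      by (simp only:)
  qed
  show ?thesis
    unfolding set_integrable_def
  proof (rule Bochner_Integration.integrable_bound)
    show "integrable (slice_area i) (\<lambda>z. indicator (slice_ball i) z *\<^sub>R
        ((norm (deriv_x0 f z))\<^sup>2 + (norm (deriv_x0 g z))\<^sup>2))"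
      using set_integral_add(1)[OF sq[OF f] sq[OF g]] by (simp add: set_integrable_def)
    have "x * y \<le> x\<^sup>2 + y\<^sup>2" if "0 \<le> x" "0 \<le> y" for x y :: real
      using sum_squares_bound[of x y] mult_nonneg_nonneg[OF that] by linarith
    then show "AE z in slice_area i. norm (indicator (slice_ball i) z *\<^sub>R (qcnj (deriv_x0 f z) * deriv_x0 g z))
        \<le> norm (indicator (slice_ball i) z *\<^sub>R ((norm (deriv_x0 f z))\<^sup>2 + (norm (deriv_x0 g z))\<^sup>2))"
      by (intro AE_I2) (auto simp: indicator_def norm_mult)
  qed (use meas in simp)
qed

text \<open>Both sides have the same power series. The combination is written exactly as in the
  linearity axiom of the Hilbert space.\<close>

lemma deriv_x0_linear:
  assumes f: "f \<in> dirichlet_space" and g: "g \<in> dirichlet_space" and z: "z \<in> ball 0 1"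
  shows "deriv_x0 ((\<lambda>q. f q * c) + g) z = deriv_x0 f z * c + deriv_x0 g z"
proof -
  obtain a where a: "has_power_series f a"
    using f by (rule dirichlet_spaceE)
  obtain b where b: "has_power_series g b"
    using g by (rule dirichlet_spaceE)
  have "has_power_series (deriv_x0 ((\<lambda>q. f q * c) + g)) (shift_coeffs (\<lambda>n. a n * c + b n))"
    by (rule has_power_series_deriv_x0[OF has_power_series_add[OF has_power_series_scale[OF a] b]])
  moreover have "shift_coeffs (\<lambda>n. a n * c + b n) = (\<lambda>n. shift_coeffs a n * c + shift_coeffs b n)"
    by (simp add: fun_eq_iff shift_coeffs_def distrib_left mult.assoc del: of_nat_Suc)
  moreover have "has_power_series ((\<lambda>q. deriv_x0 f q * c) + deriv_x0 g)
      (\<lambda>n. shift_coeffs a n * c + shift_coeffs b n)"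
    by (intro has_power_series_add has_power_series_scale has_power_series_deriv_x0 a b)
  ultimately have "has_power_series (deriv_x0 ((\<lambda>q. f q * c) + g)) (\<lambda>n. shift_coeffs a n * c + shift_coeffs b n)"
    "has_power_series ((\<lambda>q. deriv_x0 f q * c) + deriv_x0 g) (\<lambda>n. shift_coeffs a n * c + shift_coeffs b n)"
    by (simp_all only:)
  note this[unfolded has_power_series_def, THEN bspec, OF z]
  from sums_unique2[OF this] show ?thesis
    by simp
qed

lemma slice_pairing_linear:
  assumes i: "i \<in> imag_units"
    and D: "f \<in> dirichlet_space" "g \<in> dirichlet_space" "h \<in> dirichlet_space"
  shows "slice_pairing i f ((\<lambda>q. g q * c) + h) = slice_pairing i f g * c + slice_pairing i f h"
proof -
  have "slice_pairing i f ((\<lambda>q. g q * c) + h)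
     = (LINT z:slice_ball i|slice_area i.
          qcnj (deriv_x0 f z) * deriv_x0 g z * c + qcnj (deriv_x0 f z) * deriv_x0 h z)"
    unfolding slice_pairing_def
    by (rule set_lebesgue_integral_cong)
      (simp add: borel_slice_ball, auto simp: slice_ball_def deriv_x0_linear[OF D(2,3)] distrib_left mult.assoc)
  also have "\<dots> = slice_pairing i f g * c + slice_pairing i f h"
    using slice_pairing_integrable[OF i D(1,2)] slice_pairing_integrable[OF i D(1,3)]
    unfolding slice_pairing_def set_lebesgue_integral_def set_integrable_def
    by (simp add: scaleR_add_right flip: mult_scaleR_left)
  finally show ?thesis .
qed

lemma slice_pairing_cnj:
  assumes i: "i \<in> imag_units" and D: "f \<in> dirichlet_space" "g \<in> dirichlet_space"
  shows "slice_pairing i g f = qcnj (slice_pairing i f g)"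
proof -
  have "qcnj (slice_pairing i f g)
    = (LINT z|slice_area i. qcnj (indicator (slice_ball i) z *\<^sub>R (qcnj (deriv_x0 f z) * deriv_x0 g z)))"
    unfolding slice_pairing_def set_lebesgue_integral_def
    by (rule integral_bounded_linear[symmetric, OF bounded_linear_qcnj])
      (use slice_pairing_integrable[OF i D] in \<open>simp add: set_integrable_def\<close>)
  also have "\<dots> = slice_pairing i g f"
    unfolding slice_pairing_def set_lebesgue_integral_def
    by (intro Bochner_Integration.integral_cong) (auto simp: indicator_def qcnj_mult)
  finally show ?thesis ..
qed

lemma slice_pairing_self:
  assumes i: "i \<in> imag_units" and f: "has_power_series f a" and a: "summable (weighted_square a)"
  shows "slice_pairing i f f = of_real (\<Sum>n. weighted_square a (Suc n))"
proof -
  have "slice_pairing i f f = (LINT z|slice_area i. of_real (indicator (slice_ball i) z *\<^sub>R (norm (deriv_x0 f z))\<^sup>2))"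
    unfolding slice_pairing_def set_lebesgue_integral_def
    by (intro Bochner_Integration.integral_cong) (auto simp: mult_qcnj_left of_real_def)
  also have "\<dots> = of_real (LINT z:slice_ball i|slice_area i. (norm (deriv_x0 f z))\<^sup>2)"
    unfolding set_lebesgue_integral_def
    by (rule integral_bounded_linear[OF bounded_linear_of_real])
      (use slice_norm_square_integral(1)[OF assms] in \<open>simp add: set_integrable_def\<close>)
  finally show ?thesis
    by (simp add: slice_norm_square_integral(2)[OF assms])
qed

text \<open>Polarization of the diagonal values, which depend on the coefficients alone, yields the
  real part of the pairing. Right linearity then supplies the rest: replacing g by g c moves every
  other coordinate into the real part.\<close>

lemma slice_pairing_independent:
  assumes i: "i \<in> imag_units" and j: "j \<in> imag_units"
    and f: "f \<in> dirichlet_space" and g: "g \<in> dirichlet_space"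
  shows "slice_pairing i f g = slice_pairing j f g"
proof -
  have self: "slice_pairing i h h = slice_pairing j h h" if "h \<in> dirichlet_space" for h
    using that
    by (rule dirichlet_spaceE) (simp only: slice_pairing_self[OF i] slice_pairing_self[OF j])
  have polar: "2 * Re0 (slice_pairing k f h)
      = Re0 (slice_pairing k (f + h) (f + h)) - Re0 (slice_pairing k f f) - Re0 (slice_pairing k h h)"
    if h: "h \<in> dirichlet_space" and k: "k \<in> imag_units" for h k
  proof -
    note fh = dirichlet_space_add[OF f h]
    have sum: "slice_pairing k u (f + h) = slice_pairing k u f + slice_pairing k u h"
      if "u \<in> dirichlet_space" for u
      using slice_pairing_linear[OF k that f h, of 1] by simp
    have left: "Re0 (slice_pairing k (f + h) u) = Re0 (slice_pairing k f u) + Re0 (slice_pairing k h u)"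
      if u: "u \<in> dirichlet_space" for u
      using sum[OF u] slice_pairing_cnj[OF k u fh] slice_pairing_cnj[OF k u f] slice_pairing_cnj[OF k u h]
      by simp
    have "Re0 (slice_pairing k h f) = Re0 (slice_pairing k f h)"
      using slice_pairing_cnj[OF k f h] by simp
    then show ?thesis
      unfolding left[OF fh] sum[OF f] sum[OF h] plus_quat.sel by simp
  qed
  have Re: "Re0 (slice_pairing i f h) = Re0 (slice_pairing j f h)" if h: "h \<in> dirichlet_space" for h
    using polar[OF h i] polar[OF h j] self[OF f] self[OF h] self[OF dirichlet_space_add[OF f h]] by simp
  have scale: "slice_pairing k f (\<lambda>q. g q * c) = slice_pairing k f g * c" if "k \<in> imag_units" for k c
  proof -
    have "slice_pairing k f 0 = 0"
      using slice_pairing_linear[OF that f dirichlet_space_zero dirichlet_space_zero, of 1]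
      by (simp add: zero_fun_def plus_fun_def)
    then show ?thesis
      using slice_pairing_linear[OF that f g dirichlet_space_zero, of c] by simp
  qed
  have "Re0 (slice_pairing i f g * c) = Re0 (slice_pairing j f g * c)" for c
    using Re[OF dirichlet_space_scale[OF g, of c]] scale[OF i, of c] scale[OF j, of c] by simp
  \<comment> \<open>The real parts of p, p i, p j, p k are, up to sign, the four coordinates of
    p.\<close>
  from this[of 1] this[of "Quat 0 1 0 0"] this[of "Quat 0 0 1 0"] this[of "Quat 0 0 0 1"]
  show ?thesis
    by (simp add: quat_eq_iff)
qed

text \<open>Independence of the slice makes the pairing on any one unit the unique value described;
  that some unit exists gives uniqueness.\<close>

lemma dirichlet_inner_eq:
  assumes i: "i \<in> imag_units" and f: "f \<in> dirichlet_space" and g: "g \<in> dirichlet_space"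
  shows "dirichlet_inner f g = qcnj (f 0) * g 0 + slice_pairing i f g"
proof -
  have "(THE c. \<forall>j\<in>imag_units. c = slice_pairing j f g) = slice_pairing i f g"
  proof (rule the_equality)
    show "\<forall>j\<in>imag_units. slice_pairing i f g = slice_pairing j f g"
      using slice_pairing_independent[OF i _ f g] by blast
  qed (use i in blast)
  then show ?thesis
    by (simp add: dirichlet_inner_def slice_pairing_def)
qed

lemma dirichlet_inner_self:
  assumes f: "f \<in> dirichlet_space" and a: "has_power_series f a"
  shows "summable (weighted_square a)" "dirichlet_inner f f = of_real (\<Sum>n. weighted_square a n)"
proof -
  show summ: "summable (weighted_square a)"
    \<comment> \<open>Membership supplies some summable coefficient sequence, and uniqueness
      identifies it with \<open>a\<close>.\<close>
    using f by (rule dirichlet_spaceE) (use a has_power_series_unique in blast)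
  have "dirichlet_inner f f = (norm (a 0))\<^sup>2 *\<^sub>R 1 + of_real (\<Sum>n. weighted_square a (Suc n))"
    using dirichlet_inner_eq[OF imag_units_nonempty f f] has_power_series_at_0[OF a]
    by (simp add: slice_pairing_self[OF imag_units_nonempty a summ] mult_qcnj_left)
  also have "\<dots> = of_real (weighted_square a 0 + (\<Sum>n. weighted_square a (Suc n)))"
    by (simp add: weighted_square_0 of_real_def scaleR_left_distrib)
  also have "weighted_square a 0 + (\<Sum>n. weighted_square a (Suc n)) = (\<Sum>n. weighted_square a n)"
    using suminf_split_head[OF summ] by simp
  finally show "dirichlet_inner f f = of_real (\<Sum>n. weighted_square a n)" .
qed

section \<open>Completeness through the weighted sequence space\<close>

text \<open>At a radius s strictly between r and 1 the moments are bounded below by a multiple of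
  s^(2n), so a finite weighted sum bounds the terms at s. Abel's lemma turns this into summability
  at r.\<close>

lemma summable_weighted_square_powser:
  assumes a: "summable (weighted_square a)" and r: "0 \<le> r" "r < 1"
  shows "summable (\<lambda>n. norm (a n) * r ^ n)"
proof -
  define s where "s = (r + 1) / 2"
  have s: "0 \<le> s" "r < s" "s < 1"
    using r by (simp_all add: s_def)
  obtain c where c: "c > 0" "\<And>n. c * s ^ (2 * n) \<le> disc_moment 1 n"
    using disc_moment_lower_bound[OF s(1,3)] by blast
  define B where "B = (\<Sum>n. weighted_square a n)"
  have bound: "norm (a (Suc n)) * s ^ n \<le> sqrt (B / c)" for n
  proof (rule real_le_rsqrt)
    \<comment> \<open>The factor 1 is a placeholder, to be bounded by the square of
      \<open>Suc n\<close> occurring in the weight.\<close>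
    have "c * (norm (a (Suc n)) * s ^ n)\<^sup>2 = (c * s ^ (2 * n)) * (1 * (norm (a (Suc n)))\<^sup>2)"
      by (simp add: power_mult_distrib mult_ac flip: power_mult)
    also have "\<dots> \<le> disc_moment 1 n * ((real (Suc n))\<^sup>2 * (norm (a (Suc n)))\<^sup>2)"
      by (intro mult_mono c mult_right_mono one_le_power mult_nonneg_nonneg disc_moment_nonneg) auto
    also have "\<dots> = weighted_square a (Suc n)"
      by (simp add: weighted_square_def coeff_weight_def)
    also have "\<dots> \<le> B"
      unfolding B_def using sum_le_suminf[OF a, of "{Suc n}"] weighted_square_nonneg by simp
    finally show "(norm (a (Suc n)) * s ^ n)\<^sup>2 \<le> B / c"
      using c(1) by (simp add: field_simps)
  qed
  \<comment> \<open>The previous bound pairs \<open>a (Suc n)\<close> with \<open>s ^ n\<close>;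
    since s < 1 the exponent may be raised by one, and \<open>a 0\<close> is treated
    separately.\<close>
  have "norm (a n) * s ^ n \<le> norm (a 0) + sqrt (B / c)" for n
  proof (cases n)
    case 0
    have "0 \<le> sqrt (B / c)"
      using bound[of 0] by (rule order_trans[rotated]) simp
    with 0 show ?thesis
      by simp
  next
    case (Suc m)
    have "norm (a n) * s ^ n \<le> norm (a n) * s ^ m"
      using s unfolding Suc by (intro mult_left_mono power_decreasing) auto
    also have "\<dots> \<le> norm (a 0) + sqrt (B / c)"
      using bound[of m] by (simp add: Suc add_increasing)
    finally show ?thesis .
  qed
  then show ?thesis
    using Abel_lemma r(1) s(2) by blast
qed

lemma dirichlet_space_exists:
  assumes a: "summable (weighted_square a)"
  obtains f where "f \<in> dirichlet_space" "has_power_series f a"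
proof -
  define f where "f q = (if q \<in> ball 0 1 then \<Sum>n. q ^ n * a n else 0)" for q :: quat
  have f: "has_power_series f a"
    unfolding has_power_series_def
  proof
    fix q :: quat
    assume q: "q \<in> ball 0 1"
    then have "summable (\<lambda>n. q ^ n * a n)"
      using summable_imp_powser_summable[OF summable_weighted_square_powser[OF a]] by simp
    with q show "(\<lambda>n. q ^ n * a n) sums f q"
      by (simp add: f_def summable_sums)
  qed
  moreover have "f q = 0" if "q \<notin> ball 0 1" for q
    using that by (simp add: f_def)
  ultimately have "f \<in> dirichlet_space"
    using a unfolding dirichlet_space_iff by blast
  then show ?thesis
    using f by (rule that)
qed

text \<open>The usual completeness argument for a weighted space of square summable sequences:
  positive weights give coordinatewise Cauchy sequences, and the tail estimate survives the
  coordinatewise limit. Only differences occur in the hypotheses and the conclusion.\<close>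

lemma weighted_square_Cauchy_limit:
  fixes A :: "nat \<Rightarrow> nat \<Rightarrow> quat"
  assumes summ: "\<And>m k. summable (weighted_square (\<lambda>n. A m n - A k n))"
    and Cauchy: "\<And>e. e > 0 \<Longrightarrow> \<exists>N. \<forall>m\<ge>N. \<forall>k\<ge>N. (\<Sum>n. weighted_square (\<lambda>n. A m n - A k n) n) < e"
  obtains a where "\<And>e. e > 0 \<Longrightarrow> \<exists>N. \<forall>k\<ge>N. summable (weighted_square (\<lambda>n. A k n - a n)) \<and>
      (\<Sum>n. weighted_square (\<lambda>n. A k n - a n) n) \<le> e"
proof -
  have "convergent (\<lambda>k. A k n)" for n
  proof (rule Cauchy_convergent, rule CauchyI)
    fix e :: real
    assume e: "0 < e"
    then have "coeff_weight n * e\<^sup>2 > 0"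
      by (simp add: coeff_weight_pos)
    then obtain N where N: "\<And>m k. \<lbrakk>m \<ge> N; k \<ge> N\<rbrakk> \<Longrightarrow>
        (\<Sum>n. weighted_square (\<lambda>n. A m n - A k n) n) < coeff_weight n * e\<^sup>2"
      using Cauchy by blast
    have "norm (A m n - A k n) < e" if "m \<ge> N" "k \<ge> N" for m k
    proof -
      have "weighted_square (\<lambda>n. A m n - A k n) n \<le> (\<Sum>n. weighted_square (\<lambda>n. A m n - A k n) n)"
        using sum_le_suminf[OF summ, of "{n}"] weighted_square_nonneg by simp
      also have "\<dots> < coeff_weight n * e\<^sup>2"
        by (rule N[OF that])
      finally have "(norm (A m n - A k n))\<^sup>2 < e\<^sup>2"
        by (simp add: weighted_square_def coeff_weight_pos)
      then show ?thesis
        using e by (simp add: power_less_imp_less_base)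
    qed
    then show "\<exists>M. \<forall>m\<ge>M. \<forall>k\<ge>M. norm (A m n - A k n) < e"
      by blast
  qed
  then obtain a where a: "\<And>n. (\<lambda>k. A k n) \<longlonglongrightarrow> a n"
    unfolding convergent_def by metis
  have "\<exists>N. \<forall>k\<ge>N. summable (weighted_square (\<lambda>n. A k n - a n)) \<and>
      (\<Sum>n. weighted_square (\<lambda>n. A k n - a n) n) \<le> e" if "e > 0" for e
  proof -
    obtain N where N: "\<And>m k. \<lbrakk>m \<ge> N; k \<ge> N\<rbrakk> \<Longrightarrow>
        (\<Sum>n. weighted_square (\<lambda>n. A m n - A k n) n) < e"
      using Cauchy[OF \<open>e > 0\<close>] by blast
    \<comment> \<open>A finite sum may be taken to the limit in m. The bound is uniform in
      \<open>M\<close>, so it gives both summability and the estimate of the full sum; the strict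
      inequality weakens in the limit.\<close>
    have partial: "(\<Sum>n<M. weighted_square (\<lambda>n. A k n - a n) n) \<le> e" if k: "k \<ge> N" for k M
    proof (rule LIMSEQ_le_const2)
      show "(\<lambda>m. \<Sum>n<M. weighted_square (\<lambda>n. A k n - A m n) n)
          \<longlonglongrightarrow> (\<Sum>n<M. weighted_square (\<lambda>n. A k n - a n) n)"
        unfolding weighted_square_def by (intro tendsto_intros a)
      have "(\<Sum>n<M. weighted_square (\<lambda>n. A k n - A m n) n) \<le> e" if "m \<ge> N" for m
      proof -
        have "(\<Sum>n<M. weighted_square (\<lambda>n. A k n - A m n) n)
            \<le> (\<Sum>n. weighted_square (\<lambda>n. A k n - A m n) n)"
          by (intro sum_le_suminf summ weighted_square_nonneg) auto
        with N[OF k that] show ?thesis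
          by linarith
      qed
      then show "\<exists>N. \<forall>m\<ge>N. (\<Sum>n<M. weighted_square (\<lambda>n. A k n - A m n) n) \<le> e"
        by blast
    qed
    have "summable (weighted_square (\<lambda>n. A k n - a n)) \<and>
      (\<Sum>n. weighted_square (\<lambda>n. A k n - a n) n) \<le> e" if k: "k \<ge> N" for k
    proof
      show summ': "summable (weighted_square (\<lambda>n. A k n - a n))"
        by (rule summableI_nonneg_bounded[OF weighted_square_nonneg partial[OF k]])
      show "(\<Sum>n. weighted_square (\<lambda>n. A k n - a n) n) \<le> e"
        by (rule suminf_le_const[OF summ' partial[OF k]])
    qed
    then show ?thesis
      by blast
  qed
  then show ?thesis
    using that by blast
qed

lemma dirichlet_space_complete:
  assumes X: "\<And>n. X n \<in> dirichlet_space"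
    and Cauchy: "\<And>e. e > 0 \<Longrightarrow>
      \<exists>N. \<forall>m\<ge>N. \<forall>n\<ge>N. sqrt (Re0 (dirichlet_inner (X m - X n) (X m - X n))) < e"
  shows "\<exists>l\<in>dirichlet_space. (\<lambda>n. sqrt (Re0 (dirichlet_inner (X n - l) (X n - l)))) \<longlonglongrightarrow> 0"
proof -
  obtain A where A: "\<And>k. has_power_series (X k) (A k)"
    using X unfolding dirichlet_space_iff by metis
  have diff: "has_power_series (X m - X k) (\<lambda>n. A m n - A k n)" for m k
    by (rule has_power_series_diff[OF A A])
  note diff_self = dirichlet_inner_self[OF dirichlet_space_diff[OF X X] diff]
  obtain a where a: "\<And>e. e > 0 \<Longrightarrow> \<exists>N. \<forall>k\<ge>N. summable (weighted_square (\<lambda>n. A k n - a n)) \<and>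
      (\<Sum>n. weighted_square (\<lambda>n. A k n - a n) n) \<le> e"
  proof (rule weighted_square_Cauchy_limit[of A])
    show "summable (weighted_square (\<lambda>n. A m n - A k n))" for m k
      by (rule diff_self(1))
    fix e :: real
    assume "e > 0"
    \<comment> \<open>The Cauchy hypothesis concerns norms, the sequence lemma their
      squares.\<close>
    then have "sqrt e > 0"
      by simp
    then obtain N where "\<And>m n. \<lbrakk>m \<ge> N; n \<ge> N\<rbrakk> \<Longrightarrow>
        sqrt (Re0 (dirichlet_inner (X m - X n) (X m - X n))) < sqrt e"
      using Cauchy by blast
    then show "\<exists>N. \<forall>m\<ge>N. \<forall>k\<ge>N. (\<Sum>n. weighted_square (\<lambda>n. A m n - A k n) n) < e"
      by (auto simp: diff_self(2))
  qed blast
  obtain K where K: "summable (weighted_square (\<lambda>n. A K n - a n))"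
    using a[OF zero_less_one] by blast
  obtain d where d: "d \<in> dirichlet_space" "has_power_series d (\<lambda>n. A K n - a n)"
    using dirichlet_space_exists[OF K] by blast
  \<comment> \<open>What is known to be summable is the difference \<open>A K n - a n\<close>, so
    the function with coefficients \<open>a\<close> is obtained by subtracting the one realizing
    that difference from \<open>X K\<close>.\<close>
  define l where "l = X K - d"
  have l: "l \<in> dirichlet_space" "has_power_series l a"
    using dirichlet_space_diff[OF X[of K] d(1)] has_power_series_diff[OF A[of K] d(2)] by (simp_all add: l_def)
  have Xl: "Re0 (dirichlet_inner (X k - l) (X k - l)) = (\<Sum>n. weighted_square (\<lambda>n. A k n - a n) n)" for k
    using dirichlet_inner_self(2)[OF dirichlet_space_diff[OF X l(1)] has_power_series_diff[OF A l(2)]]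
    by simp
  have nonneg: "0 \<le> (\<Sum>n. weighted_square (\<lambda>n. A k n - a n) n)" for k
    using dirichlet_inner_self(1)[OF dirichlet_space_diff[OF X l(1)] has_power_series_diff[OF A l(2)]]
    by (intro suminf_nonneg weighted_square_nonneg)
  have "(\<lambda>k. \<Sum>n. weighted_square (\<lambda>n. A k n - a n) n) \<longlonglongrightarrow> 0"
  proof (rule LIMSEQ_I)
    fix e :: real
    assume "0 < e"
    then have "e / 2 > 0"
      by simp
    from a[OF this] obtain N where N: "\<And>k. k \<ge> N \<Longrightarrow> (\<Sum>n. weighted_square (\<lambda>n. A k n - a n) n) \<le> e / 2"
      by blast
    have "norm ((\<Sum>n. weighted_square (\<lambda>n. A k n - a n) n) - 0) < e" if "k \<ge> N" for k
      using N[OF that] nonneg[of k] \<open>0 < e\<close> by simp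
    then show "\<exists>N. \<forall>k\<ge>N. norm ((\<Sum>n. weighted_square (\<lambda>n. A k n - a n) n) - 0) < e"
      by blast
  qed
  then have "(\<lambda>k. sqrt (Re0 (dirichlet_inner (X k - l) (X k - l)))) \<longlonglongrightarrow> sqrt 0"
    unfolding Xl by (rule tendsto_real_sqrt)
  then show ?thesis
    using l(1) by auto
qed

section \<open>Verification of the Hilbert space axioms\<close>

theorem proposition5p10:
  shows "quat_right_hilbert_space dirichlet_space (\<lambda>f a q. f q * a) dirichlet_inner"
proof
  fix f g h :: "quat \<Rightarrow> quat" and a :: quat
  assume D: "f \<in> dirichlet_space" "g \<in> dirichlet_space" "h \<in> dirichlet_space"
  \<comment> \<open>Replacing the description operator by the pairing on a fixed slice requires
    membership of this argument as well.\<close>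
  have "(\<lambda>q. g q * a) + h \<in> dirichlet_space"
    by (intro dirichlet_space_add dirichlet_space_scale D)
  then show "dirichlet_inner f ((\<lambda>q. g q * a) + h) = dirichlet_inner f g * a + dirichlet_inner f h"
    using D by (simp add: dirichlet_inner_eq[OF imag_units_nonempty]
        slice_pairing_linear[OF imag_units_nonempty] distrib_left distrib_right mult.assoc)
next
  fix f g :: "quat \<Rightarrow> quat"
  assume D: "f \<in> dirichlet_space" "g \<in> dirichlet_space"
  show "dirichlet_inner g f = qcnj (dirichlet_inner f g)"
    using D slice_pairing_cnj[OF imag_units_nonempty D]
    by (simp add: dirichlet_inner_eq[OF imag_units_nonempty] qcnj_mult
        linear_add[OF bounded_linear.linear[OF bounded_linear_qcnj]])
next
  fix f :: "quat \<Rightarrow> quat"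
  assume f: "f \<in> dirichlet_space"
  then obtain a where a: "has_power_series f a"
    by (rule dirichlet_spaceE)
  note self = dirichlet_inner_self[OF f a]
  show "dirichlet_inner f f \<in> \<real> \<and> 0 \<le> Re0 (dirichlet_inner f f)"
    by (simp add: self(2) suminf_nonneg[OF self(1) weighted_square_nonneg])
  show "dirichlet_inner f f = 0 \<longleftrightarrow> f = 0"
  proof
    assume "dirichlet_inner f f = 0"
    then have "(\<Sum>n. weighted_square a n) = 0"
      by (simp add: self(2))
    then have "a n = 0" for n
      using suminf_eq_zero_iff[OF self(1) weighted_square_nonneg] weighted_square_eq_0_iff by blast
    then have "f q = 0" if "q \<in> ball 0 1" for q
      using a that sums_unique2[of "\<lambda>n. 0 :: quat" "f q" 0] by (auto simp: has_power_series_def)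
    then show "f = 0"
      using dirichlet_space_outside[OF f] by (auto simp: fun_eq_iff)
  next
    assume "f = 0"
    then have "has_power_series f (\<lambda>n. 0)"
      by (simp add: has_power_series_def)
    from dirichlet_inner_self(2)[OF f this] show "dirichlet_inner f f = 0"
      by (simp add: weighted_square_def)
  qed
qed (auto intro: dirichlet_space_zero dirichlet_space_add dirichlet_space_scale dirichlet_space_complete
    simp: fun_eq_iff distrib_left distrib_right mult.assoc)

end
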